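(* For every $A>0$ there is a constant $C_A$ (depending only on $A$) such that for every integer $n\ge1$ and every $\xi\in\mathbb{Z}/3^n\mathbb{Z}$ not divisible by $3$, $$\Big|\mathbb{E}\,e^{-2\pi i\xi\,\mathbf{Syrac}(\mathbb{Z}/3^n\mathbb{Z})/3^n}\Big|\le C_A\,n^{-A}.$$
   Context: $\mathbf{Syrac}(\mathbb{Z}/3^n\mathbb{Z})$ (the Syracuse random variable) is a random variable on $\mathbb{Z}/3^n\mathbb{Z}$ with the distribution of $F_n(\mathbf{a}_1,\dots,\mathbf{a}_n)\bmod 3^n$, where $\mathbf{a}_1,\dots,\mathbf{a}_n$ are independent with $\mathbb{P}(\mathbf{a}_i=a)=2^{-a}$ for $a=1,2,\dots$, and $$F_n(a_1,\dots,a_n):=\sum_{m=1}^n3^{n-m}2^{-(a_m+a_{m+1}+\dots+a_n)}\in\mathbb{Z}[\tfrac12].$$ Here $x\mapsto x\bmod 3^n$ is the unique ring homomorphism $\mathbb{Z}[\frac12]\to\mathbb{Z}/3^n\mathbb{Z}$. *)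

theory Defs
  imports "HOL-Probability.Probability" "HOL-Number_Theory.Residues"
begin

section \<open>The ring of dyadic rationals and its reduction modulo powers of three\<close>

definition dyadics :: "rat set" where
  "dyadics = {of_int a / 2 ^ k | (a :: int) (k :: nat). True}"

definition dyadic_ring :: "rat ring" where
  "dyadic_ring = \<lparr>carrier = dyadics, monoid.mult = (*), one = 1, zero = 0, add = (+)\<rparr>"

text \<open>
  The extensionality condition only fixes the values outside the dyadic rationals, so that the
  homomorphism is unique as a HOL function (see \<open>ex1_dyadic_mod\<close>). For \<open>n = 0\<close> the library ring
  \<open>residue_ring 1\<close> is degenerate and \<open>dyadic_mod\<close> is not meaningful.
\<close>

definition dyadic_mod :: "nat \<Rightarrow> rat \<Rightarrow> int" where
  "dyadic_mod n = (THE h. h \<in> ring_hom dyadic_ring (residue_ring (3 ^ n)) \<and> h \<in> extensional dyadics)"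

lemma dyadicsI: "of_int a / 2 ^ k \<in> dyadics"
  by (auto simp: dyadics_def)

lemma of_int_in_dyadics: "of_int a \<in> dyadics"
  using dyadicsI[of a 0] by simp

lemma dyadics_mult: "x \<in> dyadics \<Longrightarrow> y \<in> dyadics \<Longrightarrow> x * y \<in> dyadics"
proof -
  assume "x \<in> dyadics" "y \<in> dyadics"
  then obtain a k b l where "x = of_int a / 2 ^ k" "y = of_int b / 2 ^ l"
    by (auto simp: dyadics_def)
  hence "x * y = of_int (a * b) / 2 ^ (k + l)"
    by (simp add: power_add)
  thus ?thesis using dyadicsI by metis
qed

lemma dyadics_add: "x \<in> dyadics \<Longrightarrow> y \<in> dyadics \<Longrightarrow> x + y \<in> dyadics"
proof -
  assume "x \<in> dyadics" "y \<in> dyadics"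
  then obtain a k b l where "x = of_int a / 2 ^ k" "y = of_int b / 2 ^ l"
    by (auto simp: dyadics_def)
  hence "x + y = of_int (a * 2 ^ l + b * 2 ^ k) / 2 ^ (k + l)"
    by (simp add: power_add add_divide_distrib)
  thus ?thesis using dyadicsI by metis
qed

lemma coprime_2_3_power: "coprime ((2 :: int) ^ k) (3 ^ n)"
  by simp

lemma ring_hom_dyadic_cong:
  assumes n: "n \<ge> 1" and h: "h \<in> ring_hom dyadic_ring (residue_ring (3 ^ n))"
  shows "[h (of_int a / 2 ^ k) * 2 ^ k = a] (mod 3 ^ n)"
proof -
  have add: "[h (x + y) = h x + h y] (mod 3 ^ n)" if "x \<in> dyadics" "y \<in> dyadics" for x y
    using h that by (simp add: ring_hom_def dyadic_ring_def residue_ring_def)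
  have mult: "[h (x * y) = h x * h y] (mod 3 ^ n)" if "x \<in> dyadics" "y \<in> dyadics" for x y
    using h that by (simp add: ring_hom_def dyadic_ring_def residue_ring_def)
  have one: "h 1 = 1"
    using h by (simp add: ring_hom_def dyadic_ring_def residue_ring_def)
  have zero: "[h 0 = 0] (mod 3 ^ n)"
    using add[of 0 0] of_int_in_dyadics[of 0] by (simp add: cong_iff_dvd_diff)
  have int: "[h (of_int b) = b] (mod 3 ^ n)" for b
  proof (induction b rule: int_induct[where k = 0])
    case base
    show ?case using zero by simp
  next
    case (step1 i)
    have "[h (of_int i + 1) = h (of_int i) + 1] (mod 3 ^ n)"
      using add[of "of_int i" 1] of_int_in_dyadics[of i] of_int_in_dyadics[of 1] one by simp
    also have "[h (of_int i) + 1 = i + 1] (mod 3 ^ n)"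
      using step1 by (intro cong_add) auto
    finally show ?case by simp
  next
    case (step2 i)
    have "[h (of_int i) = h (of_int (i - 1)) + 1] (mod 3 ^ n)"
      using add[of "of_int (i - 1)" 1] of_int_in_dyadics[of "i - 1"] of_int_in_dyadics[of 1] one
      by simp
    hence "[h (of_int (i - 1)) + 1 = i] (mod 3 ^ n)"
      using step2 cong_sym cong_trans by blast
    thus ?case by (simp add: cong_iff_dvd_diff algebra_simps)
  qed
  have "[h (of_int a / 2 ^ k) * 2 ^ k = h (of_int a / 2 ^ k) * h (of_int (2 ^ k))] (mod 3 ^ n)"
    by (intro cong_mult cong_refl cong_sym[OF int])
  also have "[h (of_int a / 2 ^ k) * h (of_int (2 ^ k)) = h (of_int a / 2 ^ k * of_int (2 ^ k))] (mod 3 ^ n)"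
    by (intro cong_sym[OF mult] dyadicsI of_int_in_dyadics)
  also have "[h (of_int a / 2 ^ k * of_int (2 ^ k)) = a] (mod 3 ^ n)"
    using int[of a] by simp
  finally show ?thesis .
qed

lemma cong_2_power_unique:
  assumes "[r * 2 ^ k = a] (mod 3 ^ n)" "[s * 2 ^ l = b] (mod 3 ^ n)"
    and "(of_int a :: rat) / 2 ^ k = of_int b / 2 ^ l"
    and "r \<in> {0..3 ^ n - 1}" "s \<in> {0..3 ^ n - 1}"
  shows "r = (s :: int)"
proof -
  have "(of_int (a * 2 ^ l) :: rat) = of_int (b * 2 ^ k)"
    using assms(3) by (simp add: field_simps)
  hence ab: "a * 2 ^ l = b * 2 ^ k" by linarith
  have "[r * 2 ^ k * 2 ^ l = a * 2 ^ l] (mod 3 ^ n)"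
    by (intro cong_mult assms cong_refl)
  moreover have "[s * 2 ^ l * 2 ^ k = b * 2 ^ k] (mod 3 ^ n)"
    by (intro cong_mult assms cong_refl)
  ultimately have "[r * 2 ^ k * 2 ^ l = s * 2 ^ l * 2 ^ k] (mod 3 ^ n)"
    unfolding ab using cong_sym cong_trans by blast
  hence "[r * 2 ^ (k + l) = s * 2 ^ (k + l)] (mod 3 ^ n)"
    by (simp only: power_add mult_ac)
  hence "[r = s] (mod 3 ^ n)"
    unfolding cong_mult_rcancel[OF coprime_2_3_power] .
  thus ?thesis using assms(4,5) by (simp add: cong_def)
qed

lemma ex1_dyadic_mod:
  assumes n: "n \<ge> 1"
  shows "\<exists>!h. h \<in> ring_hom dyadic_ring (residue_ring (3 ^ n)) \<and> h \<in> extensional dyadics"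
proof (rule ex_ex1I)
  define P where "P = (\<lambda>x r. r \<in> {0..3 ^ n - 1} \<and>
    (\<exists>(a :: int) k. x = (of_int a / 2 ^ k :: rat) \<and> [r * 2 ^ k = a] (mod 3 ^ n)))"
  have ex: "\<exists>r. P x r" if "x \<in> dyadics" for x
  proof -
    from that obtain a k where x: "x = of_int a / 2 ^ k"
      by (auto simp: dyadics_def)
    obtain i where i: "[2 ^ k * i = 1] (mod (3 ^ n :: int))"
      using cong_solve_coprime_int[OF coprime_2_3_power] by blast
    have "[a * i mod 3 ^ n * 2 ^ k = a * i * 2 ^ k] (mod 3 ^ n)"
      by (simp add: cong_def mod_mult_left_eq)
    also have "a * i * 2 ^ k = a * (2 ^ k * i)" by simp
    also have "[\<dots> = a * 1] (mod 3 ^ n)" by (intro cong_mult i cong_refl)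
    finally have "P x (a * i mod 3 ^ n)" using x by (auto simp: P_def)
    thus ?thesis ..
  qed
  have uniq: "r = s" if "P x r" "P x s" for x r s
  proof -
    from that(1) obtain a k where a: "x = of_int a / 2 ^ k" "[r * 2 ^ k = a] (mod 3 ^ n)"
      and r: "r \<in> {0..3 ^ n - 1}"
      unfolding P_def by blast
    from that(2) obtain b l where b: "x = of_int b / 2 ^ l" "[s * 2 ^ l = b] (mod 3 ^ n)"
      and s: "s \<in> {0..3 ^ n - 1}"
      unfolding P_def by blast
    show ?thesis
      by (rule cong_2_power_unique[OF a(2) b(2) _ r s]) (use a(1) b(1) in simp)
  qed
  define h where "h = restrict (\<lambda>x. SOME r. P x r) dyadics"
  have hP: "P x (h x)" if "x \<in> dyadics" for x
    using someI_ex[OF ex[OF that]] that by (simp add: h_def)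
  have "h \<in> ring_hom dyadic_ring (residue_ring (3 ^ n))"
  proof (rule ring_hom_memI)
    show "h x \<in> carrier (residue_ring (3 ^ n))" if "x \<in> carrier dyadic_ring" for x
      using hP[of x] that by (simp add: P_def dyadic_ring_def residue_ring_def)
  next
    have "P 1 1" unfolding P_def
      using power_increasing[of 1 n "3 :: int"] n
      by (auto intro!: exI[of _ 1] exI[of _ 0])
    moreover have "P 1 (h 1)" using hP[of 1] of_int_in_dyadics[of 1] by simp
    ultimately show "h \<one>\<^bsub>dyadic_ring\<^esub> = \<one>\<^bsub>residue_ring (3 ^ n)\<^esub>"
      using uniq by (simp add: dyadic_ring_def residue_ring_def)
  next
    fix x y assume "x \<in> carrier dyadic_ring" "y \<in> carrier dyadic_ring"
    hence xy: "x \<in> dyadics" "y \<in> dyadics" by (simp_all add: dyadic_ring_def)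
    from hP[OF xy(1)] obtain a k where a: "x = of_int a / 2 ^ k" "[h x * 2 ^ k = a] (mod 3 ^ n)"
      by (auto simp: P_def)
    from hP[OF xy(2)] obtain b l where b: "y = of_int b / 2 ^ l" "[h y * 2 ^ l = b] (mod 3 ^ n)"
      by (auto simp: P_def)
    have "[(h x * h y) mod 3 ^ n * 2 ^ (k + l) = (h x * h y) * 2 ^ (k + l)] (mod 3 ^ n)"
      by (simp add: cong_def mod_mult_left_eq)
    also have "(h x * h y) * 2 ^ (k + l) = (h x * 2 ^ k) * (h y * 2 ^ l)"
      by (simp add: power_add)
    also have "[\<dots> = a * b] (mod 3 ^ n)" by (intro cong_mult a b)
    finally have c: "[(h x * h y) mod 3 ^ n * 2 ^ (k + l) = a * b] (mod 3 ^ n)" .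
    have "x * y = of_int (a * b) / 2 ^ (k + l)" using a b by (simp add: power_add)
    with c have "P (x * y) ((h x * h y) mod 3 ^ n)" unfolding P_def by fastforce
    with hP[OF dyadics_mult[OF xy]] uniq
    show "h (x \<otimes>\<^bsub>dyadic_ring\<^esub> y) = h x \<otimes>\<^bsub>residue_ring (3 ^ n)\<^esub> h y"
      by (simp add: dyadic_ring_def residue_ring_def)
    have "[(h x + h y) mod 3 ^ n * 2 ^ (k + l) = (h x + h y) * 2 ^ (k + l)] (mod 3 ^ n)"
      by (simp add: cong_def mod_mult_left_eq)
    also have "(h x + h y) * 2 ^ (k + l) = (h x * 2 ^ k) * 2 ^ l + (h y * 2 ^ l) * 2 ^ k"
      by (simp add: power_add algebra_simps)
    also have "[\<dots> = a * 2 ^ l + b * 2 ^ k] (mod 3 ^ n)"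
      by (intro cong_mult cong_add cong_refl a b)
    finally have d: "[(h x + h y) mod 3 ^ n * 2 ^ (k + l) = a * 2 ^ l + b * 2 ^ k] (mod 3 ^ n)" .
    have "x + y = of_int (a * 2 ^ l + b * 2 ^ k) / 2 ^ (k + l)"
      unfolding a(1) b(1) by (simp add: power_add add_divide_distrib)
    with d have "P (x + y) ((h x + h y) mod 3 ^ n)" unfolding P_def by fastforce
    with hP[OF dyadics_add[OF xy]] uniq
    show "h (x \<oplus>\<^bsub>dyadic_ring\<^esub> y) = h x \<oplus>\<^bsub>residue_ring (3 ^ n)\<^esub> h y"
      by (simp add: dyadic_ring_def residue_ring_def)
  qed
  thus "\<exists>h. h \<in> ring_hom dyadic_ring (residue_ring (3 ^ n)) \<and> h \<in> extensional dyadics"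
    by (auto simp: h_def)
next
  fix g h :: "rat \<Rightarrow> int"
  assume g: "g \<in> ring_hom dyadic_ring (residue_ring (3 ^ n)) \<and> g \<in> extensional dyadics"
    and h: "h \<in> ring_hom dyadic_ring (residue_ring (3 ^ n)) \<and> h \<in> extensional dyadics"
  show "g = h"
  proof (rule extensionalityI)
    fix x :: rat assume x: "x \<in> dyadics"
    then obtain a k where ak: "x = of_int a / 2 ^ k" by (auto simp: dyadics_def)
    have "g x \<in> {0..3 ^ n - 1}" "h x \<in> {0..3 ^ n - 1}"
      using g h x by (auto simp: ring_hom_def dyadic_ring_def residue_ring_def Pi_def)
    moreover have "[g x * 2 ^ k = a] (mod 3 ^ n)" "[h x * 2 ^ k = a] (mod 3 ^ n)"
      using ring_hom_dyadic_cong[OF n] g h ak by auto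
    ultimately show "g x = h x" by (intro cong_2_power_unique[of _ k a n _ k a]) auto
  qed (use g h in auto)
qed

lemma dyadic_mod_ring_hom:
  "n \<ge> 1 \<Longrightarrow> dyadic_mod n \<in> ring_hom dyadic_ring (residue_ring (3 ^ n))"
  using theI'[OF ex1_dyadic_mod] unfolding dyadic_mod_def by blast

lemma dyadic_mod_in_range:
  "n \<ge> 1 \<Longrightarrow> x \<in> dyadics \<Longrightarrow> dyadic_mod n x \<in> {0..3 ^ n - 1}"
  using dyadic_mod_ring_hom[of n] by (auto simp: ring_hom_def dyadic_ring_def residue_ring_def Pi_def)

lemma dyadic_mod_cong:
  "n \<ge> 1 \<Longrightarrow> [dyadic_mod n (of_int a / 2 ^ k) * 2 ^ k = a] (mod 3 ^ n)"
  using ring_hom_dyadic_cong dyadic_mod_ring_hom by blast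


section \<open>The Syracuse random variable\<close>

text \<open>
  The library distribution \<open>geometric_pmf (1/2)\<close> starts at \<open>0\<close>; the shift makes it start at \<open>1\<close>.
\<close>

definition geom2_pmf :: "nat pmf" where
  "geom2_pmf = map_pmf Suc (geometric_pmf (1 / 2))"

lemma pmf_geom2: "pmf geom2_pmf a = (if a = 0 then 0 else 1 / 2 ^ a)"
proof (cases a)
  case 0
  have "0 \<notin> set_pmf geom2_pmf" by (auto simp: geom2_pmf_def)
  thus ?thesis using 0 by (simp add: set_pmf_iff)
next
  case (Suc b)
  have "pmf geom2_pmf (Suc b) = pmf (geometric_pmf (1 / 2)) b"
    unfolding geom2_pmf_def by (rule pmf_map_inj') simp
  thus ?thesis using Suc by (simp add: power_divide)
qed

definition syrac_offset :: "nat \<Rightarrow> (nat \<Rightarrow> nat) \<Rightarrow> rat" where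
  "syrac_offset n a = (\<Sum>m = 1..n. 3 ^ (n - m) * 2 powi (- int (\<Sum>i = m..n. a i)))"

lemma syrac_offset_in_dyadics: "syrac_offset n a \<in> dyadics"
proof -
  have "(\<Sum>m\<in>A. 3 ^ (n - m) * 2 powi (- int (\<Sum>i = m..n. a i)) :: rat) \<in> dyadics"
    if "finite A" for A
    using that
  proof induction
    case empty
    show ?case using of_int_in_dyadics[of 0] by simp
  next
    case (insert m A)
    have "(3 ^ (n - m) * 2 powi (- int (\<Sum>i = m..n. a i)) :: rat) =
            of_int (3 ^ (n - m)) / 2 ^ (\<Sum>i = m..n. a i)"
      by (simp add: power_int_minus divide_inverse flip: of_nat_sum)
    thus ?case using insert dyadics_add dyadicsI by (metis sum.insert)
  qed
  thus ?thesis unfolding syrac_offset_def by blast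
qed

text \<open>
  The distribution of the Syracuse random variable on \<open>\<int>/3\<^sup>n\<int>\<close>, whose elements are the
  representatives \<open>0, \<dots>, 3\<^sup>n - 1\<close> as in \<open>residue_ring\<close>. The product distribution \<open>Pi_pmf\<close> is the law
  of independent coordinates \<open>a 1, \<dots>, a n\<close>; its default value \<open>0\<close> at all other indices is not used.
\<close>

definition syrac_pmf :: "nat \<Rightarrow> int pmf" where
  "syrac_pmf n = map_pmf (\<lambda>a. dyadic_mod n (syrac_offset n a)) (Pi_pmf {1..n} 0 (\<lambda>_. geom2_pmf))"

lemma set_syrac_pmf: "n \<ge> 1 \<Longrightarrow> set_pmf (syrac_pmf n) \<subseteq> carrier (residue_ring (3 ^ n))"
  using dyadic_mod_in_range[OF _ syrac_offset_in_dyadics]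
  by (auto simp: syrac_pmf_def residue_ring_def)

end

theory Submission
  imports Defs "HOL-Real_Asymp.Real_Asymp"
begin

text \<open>
  The numbers \<open>a 1, \<dots>, a n\<close> are the gaps between the heads in a sequence of fair coin flips. After
  \<open>2 * k\<close> flips with \<open>i\<close> heads, the conditional characteristic function of the remaining sum has a
  modulus \<open>F i k\<close>, and two flips relate row \<open>k\<close> to row \<open>k + 1\<close>: the outcomes head-tail and
  tail-head lead to the same point, with phases that differ by \<open>3 ^ i * 4 ^ - (k + 1) * \<xi> / 3 ^ n\<close>.
  At white points, where this phase is not close to an integer, the modulus is damped by a
  constant factor.

  From a black point the phase is divided by \<open>4\<close> at each step upwards until the first white
  row, so a black run has length \<open>h\<close> at most \<open>4/5\<close> of the number \<open>r = n - i\<close> of missing heads. As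
  \<open>3 < 4\<close>, the walk meets a white point at the exit row with probability at least \<open>1/2\<close>. If \<open>h\<close>
  is much smaller than \<open>r\<close>, this single gain beats the loss in \<open>r powr (- A)\<close>. Otherwise that loss is a
  factor \<open>10 powr A\<close>, and many gains are needed. In row \<open>q\<close> above the exit row, starting points of
  black runs longer than \<open>s\<close> form clusters of diameter \<open>2 * q\<close> that are \<open>s\<close> apart, so the walk,
  whose position has a unimodal distribution of width \<open>sqrt h\<close>, meets one with probability \<open>O(q / s)\<close>.
  With \<open>s\<close> a large multiple of \<open>(q + 1) ^ 3\<close> the total probability is small, and apart from
  that event the walk gains boundedly many times within boundedly many rows. Hence the supremum of
  \<open>F i k * (n - i) powr A\<close> is controlled by the values for bounded \<open>n - i\<close>.
\<close>

section \<open>Averages over a binomial distribution\<close>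

text \<open>\<open>bav m f i\<close> is the expectation of \<open>f (i + X)\<close> for a binomial variable \<open>X\<close> with parameters \<open>m\<close> and \<open>1/2\<close>.\<close>

primrec bav :: "nat \<Rightarrow> (nat \<Rightarrow> real) \<Rightarrow> nat \<Rightarrow> real" where
  "bav 0 f i = f i"
| "bav (Suc m) f i = (bav m f i + bav m f (Suc i)) / 2"

lemma bav_add: "bav (m + n) f i = bav m (bav n f) i"
  by (induction m arbitrary: i) auto

lemma bav_mono:
  assumes "\<And>j. j \<le> m \<Longrightarrow> f (i + j) \<le> g (i + j)"
  shows "bav m f i \<le> bav m g i"
  using assms
proof (induction m arbitrary: i)
  case 0
  show ?case using 0[of 0] by simp
next
  case (Suc m)
  have "bav m f i \<le> bav m g i"
    by (rule Suc.IH) (simp add: Suc.prems)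
  moreover have "bav m f (Suc i) \<le> bav m g (Suc i)"
    by (rule Suc.IH) (use Suc.prems[of "Suc _"] in simp)
  ultimately show ?case by simp
qed

lemma bav_const [simp]: "bav m (\<lambda>_. c) i = c"
  by (induction m arbitrary: i) auto

lemma bav_plus: "bav m (\<lambda>j. f j + g j) i = bav m f i + bav m g i"
  by (induction m arbitrary: i) (auto simp: field_simps)

lemma bav_cmult: "bav m (\<lambda>j. c * f j) i = c * bav m f i"
  by (induction m arbitrary: i) (auto simp: field_simps)

lemma bav_sum: "finite A \<Longrightarrow> bav m (\<lambda>j. \<Sum>a\<in>A. f a j) i = (\<Sum>a\<in>A. bav m (f a) i)"
  by (induction A rule: finite_induct) (auto simp: bav_plus)

lemma bav_nonneg: "(\<And>j. 0 \<le> f j) \<Longrightarrow> 0 \<le> bav m f i"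
  by (induction m arbitrary: i) auto

lemma bav_eq_sum: "bav m f i = (\<Sum>j\<le>m. real (m choose j) * f (i + j)) / 2 ^ m"
proof (induction m arbitrary: i)
  case 0
  show ?case by simp
next
  case (Suc m)
  have "(\<Sum>j\<le>Suc m. real (Suc m choose j) * f (i + j)) =
      f i + (\<Sum>j\<le>m. real (m choose Suc j) * f (i + Suc j)) + (\<Sum>j\<le>m. real (m choose j) * f (Suc i + j))"
    by (subst sum.atMost_Suc_shift) (simp add: sum.distrib algebra_simps)
  also have "f i + (\<Sum>j\<le>m. real (m choose Suc j) * f (i + Suc j)) = (\<Sum>j\<le>Suc m. real (m choose j) * f (i + j))"
    by (subst sum.atMost_Suc_shift) simp
  also have "\<dots> = (\<Sum>j\<le>m. real (m choose j) * f (i + j))"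
    by simp
  finally show ?case by (simp add: Suc field_simps)
qed

text \<open>Reflecting \<open>j\<close> to \<open>2 * h - j\<close> matches the coefficients above
  \<open>h\<close> with those below, so the part up to \<open>h\<close>, which also has the middle
  one, carries at least half of the mass.\<close>

lemma bav_lower_half: "1 / 2 \<le> bav (2 * h) (\<lambda>j. if j \<le> i + h then 1 else 0) i"
proof -
  let ?c = "\<lambda>j. real (2 * h choose j)"
  have "?c (2 * h - j) = ?c j" if "j \<le> 2 * h" for j
    using binomial_symmetric[OF that] by simp
  hence "(\<Sum>j\<in>{h<..2*h}. ?c j) = (\<Sum>j<h. ?c j)"
    by (intro sum.reindex_bij_witness[of _ "\<lambda>j. 2 * h - j" "\<lambda>j. 2 * h - j"]) auto
  also have "\<dots> \<le> (\<Sum>j\<le>h. ?c j)"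
    by (rule sum_mono2) auto
  finally have le: "(\<Sum>j\<in>{h<..2*h}. ?c j) \<le> (\<Sum>j\<le>h. ?c j)" .
  have "{..2*h} = {..h} \<union> {h<..2*h}" by auto
  moreover have "(\<Sum>j\<in>{..h} \<union> {h<..2*h}. ?c j) = (\<Sum>j\<le>h. ?c j) + (\<Sum>j\<in>{h<..2*h}. ?c j)"
    by (intro sum.union_disjoint) auto
  ultimately have "(\<Sum>j\<le>2*h. ?c j) = (\<Sum>j\<le>h. ?c j) + (\<Sum>j\<in>{h<..2*h}. ?c j)"
    by simp
  moreover have "(\<Sum>j\<le>2*h. ?c j) = 2 ^ (2 * h)"
    using arg_cong[OF choose_row_sum[of "2 * h"], of real] by simp
  ultimately have "2 ^ (2 * h) \<le> 2 * (\<Sum>j\<le>h. ?c j)" using le by linarith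
  moreover have "(\<Sum>j\<le>2*h. ?c j * (if i + j \<le> i + h then 1 else 0)) = (\<Sum>j\<le>h. ?c j)"
    by (rule sum.mono_neutral_cong_right) auto
  ultimately show ?thesis
    by (simp add: bav_eq_sum field_simps)
qed

text \<open>The squared form suits induction: consecutive central coefficients have ratio
  \<open>2 * (2 * T + 1) / (T + 1)\<close>, and
  \<open>(2 * T + 1) * (2 * T + 3) \<le> 4 * (T + 1)\<^sup>2\<close>.\<close>

lemma central_binomial_upper: "real (2 * T choose T) * sqrt (2 * real T + 1) \<le> 4 ^ T"
proof -
  have "(real (2 * T choose T))\<^sup>2 * (2 * T + 1) \<le> (4 ^ T)\<^sup>2"
  proof (induction T)
    case (Suc T)
    define b where "b = real (2 * T choose T)"
    have "Suc (2 * T) choose T = Suc (2 * T) choose Suc T"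
      using binomial_symmetric[of T "Suc (2 * T)"] by simp
    hence c1: "Suc T * (Suc (2 * T) choose T) = Suc (2 * T) * (2 * T choose T)"
      using Suc_times_binomial[of T "2 * T"] by metis
    have "Suc T * (2 * Suc T choose Suc T) = 2 * (Suc T * (Suc (2 * T) choose T))"
      using Suc_times_binomial[of T "Suc (2 * T)"] by (simp add: mult.assoc del: binomial_Suc_Suc)
    also have "\<dots> = 2 * Suc (2 * T) * (2 * T choose T)"
      unfolding c1 by simp
    finally have "real (Suc T * (2 * Suc T choose Suc T)) = real (2 * Suc (2 * T) * (2 * T choose T))"
      by (rule arg_cong)
    hence r: "(real T + 1) * real (2 * Suc T choose Suc T) = 2 * (2 * real T + 1) * b"
      unfolding b_def of_nat_mult of_nat_Suc of_nat_numeral by (simp only: ac_simps)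
    have IH: "b\<^sup>2 * (2 * real T + 1) \<le> (4 ^ T)\<^sup>2" using Suc by (simp add: b_def add.commute)
    have "(real T + 1)\<^sup>2 * ((real (2 * Suc T choose Suc T))\<^sup>2 * (2 * real T + 3)) =
        (2 * (2 * real T + 1) * b)\<^sup>2 * (2 * real T + 3)"
      unfolding r[symmetric] power_mult_distrib by (rule mult.assoc[symmetric])
    also have "\<dots> = 4 * ((2 * real T + 1) * (2 * real T + 3)) * (b\<^sup>2 * (2 * real T + 1))"
      by (simp add: power2_eq_square algebra_simps)
    also have "\<dots> \<le> 4 * ((2 * real T + 1) * (2 * real T + 3)) * (4 ^ T)\<^sup>2"
      by (rule mult_left_mono[OF IH]) simp
    also have "\<dots> \<le> 4 * (4 * (real T + 1)\<^sup>2) * (4 ^ T)\<^sup>2"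
      by (intro mult_right_mono mult_left_mono) (auto simp: power2_eq_square algebra_simps)
    also have "\<dots> = (real T + 1)\<^sup>2 * (4 ^ Suc T)\<^sup>2"
      by (simp add: power2_eq_square)
    finally have "(real (2 * Suc T choose Suc T))\<^sup>2 * (2 * real T + 3) \<le> (4 ^ Suc T)\<^sup>2"
      by (rule mult_left_le_imp_le) simp
    thus ?case by (simp add: algebra_simps)
  qed simp
  hence "sqrt ((real (2 * T choose T))\<^sup>2 * (2 * T + 1)) \<le> sqrt ((4 ^ T)\<^sup>2)"
    by (rule real_sqrt_le_mono)
  thus ?thesis by (simp add: real_sqrt_mult add.commute)
qed

text \<open>Points at distance at least \<open>s\<close> from the centre are charged to disjoint
  intervals of total mass at most \<open>4 ^ T\<close>. Each side has at most one closer point,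
  bounded by the central coefficient.\<close>

lemma sum_choose_separated:
  fixes D :: "nat set" and s :: nat
  assumes D: "finite D" and sep: "\<And>x y. x \<in> D \<Longrightarrow> y \<in> D \<Longrightarrow> x < y \<Longrightarrow> s < y - x" and s: "0 < s"
  shows "(\<Sum>j\<in>D. real (2 * T choose j)) \<le> 4 ^ T / s + 2 * real (2 * T choose T)"
proof -
  let ?c = "\<lambda>j. real (2 * T choose j)"
  define D1 where "D1 = {j\<in>D. j + s \<le> T \<or> T + s \<le> j \<and> j \<le> 2 * T}"
  define D2 where "D2 = {j\<in>D. T < j + s \<and> j \<le> T}"
  define D3 where "D3 = {j\<in>D. T < j \<and> j < T + s}"
  define D4 where "D4 = {j\<in>D. 2 * T < j}"
  \<comment> \<open>By unimodality, the coefficient at \<open>j\<close> is at most each of the \<open>s\<close> coefficients next to it towards the centre \<open>T\<close>.\<close>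
  define J where "J = (\<lambda>j. if j \<le> T then {j..<j+s} else {j-s<..j})"
  have fin: "finite D1" "finite D2" "finite D3" "finite D4" using D by (auto simp: D1_def D2_def D3_def D4_def)
  have near: "sum ?c X \<le> ?c T" if X: "X \<subseteq> D"
      and close: "\<And>x y. x \<in> X \<Longrightarrow> y \<in> X \<Longrightarrow> x < y \<Longrightarrow> y - x < s" for X
  proof -
    have "x = y" if "x \<in> X" "y \<in> X" for x y
      using that X sep[of x y] sep[of y x] close[of x y] close[of y x]
      by (cases x y rule: linorder_cases) fastforce+
    hence "X = {} \<or> (\<exists>x. X = {x})" by blast
    thus ?thesis using binomial_maximum'[of T] by auto
  qed
  have D2: "sum ?c D2 \<le> ?c T" by (rule near) (auto simp: D2_def)
  have D3: "sum ?c D3 \<le> ?c T" by (rule near) (auto simp: D3_def)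
  have D4: "sum ?c D4 = 0" by (rule sum.neutral) (auto simp: D4_def)
  have cJ: "?c j \<le> ?c y" if "j \<in> D1" "y \<in> J j" for j y
  proof (cases "j \<le> T")
    case True
    thus ?thesis using that by (auto simp: D1_def J_def intro!: binomial_mono)
  next
    case False
    thus ?thesis using that by (auto simp: D1_def J_def intro!: binomial_antimono)
  qed
  have card: "card (J j) = s" if "j \<in> D1" for j
    using that s by (auto simp: D1_def J_def)
  have finJ: "finite (J j)" for j by (simp add: J_def)
  have disj: "J x \<inter> J y = {}" if "x \<in> D1" "y \<in> D1" "x < y" for x y
    using that sep[of x y] by (auto simp: D1_def J_def)
  have "s * sum ?c D1 = (\<Sum>j\<in>D1. \<Sum>y\<in>J j. ?c j)"
    by (simp add: card sum_distrib_left)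
  also have "\<dots> \<le> (\<Sum>j\<in>D1. \<Sum>y\<in>J j. ?c y)"
    by (intro sum_mono cJ)
  also have "\<dots> = (\<Sum>y\<in>(\<Union>j\<in>D1. J j). ?c y)"
  proof (rule sum.UNION_disjoint[symmetric])
    show "\<forall>i\<in>D1. \<forall>j\<in>D1. i \<noteq> j \<longrightarrow> J i \<inter> J j = {}"
      using disj by (metis inf_commute linorder_neqE_nat)
  qed (use fin finJ in auto)
  also have "\<dots> \<le> (\<Sum>y\<le>2*T. ?c y)"
  proof (rule sum_mono2)
    show "(\<Union>j\<in>D1. J j) \<subseteq> {..2*T}" by (auto simp: D1_def J_def split: if_splits)
  qed auto
  also have "\<dots> = 4 ^ T"
    using arg_cong[OF choose_row_sum[of "2 * T"], of real] by (simp add: power_mult)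
  finally have D1: "sum ?c D1 \<le> 4 ^ T / s" using s by (simp add: field_simps)
  have "D = D1 \<union> (D2 \<union> (D3 \<union> D4))" by (auto simp: D1_def D2_def D3_def D4_def)
  hence "sum ?c D = sum ?c (D1 \<union> (D2 \<union> (D3 \<union> D4)))" by simp
  also have "\<dots> = sum ?c D1 + sum ?c (D2 \<union> (D3 \<union> D4))"
    using fin s by (intro sum.union_disjoint) (auto simp: D1_def D2_def D3_def D4_def)
  also have "sum ?c (D2 \<union> (D3 \<union> D4)) = sum ?c D2 + sum ?c (D3 \<union> D4)"
    using fin by (intro sum.union_disjoint) (auto simp: D2_def D3_def D4_def)
  also have "sum ?c (D3 \<union> D4) \<le> sum ?c D3 + sum ?c D4"
    using fin by (simp add: sum_Un sum_nonneg)
  finally show ?thesis using D1 D2 D3 D4 by linarith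
qed

lemma bav_clustered:
  fixes D :: "nat set" and s w :: nat
  assumes D: "\<And>x y. x \<in> D \<Longrightarrow> y \<in> D \<Longrightarrow> x < y \<Longrightarrow> y - x \<le> s \<Longrightarrow> y - x \<le> w" and s: "0 < s"
  shows "bav (2 * T) (\<lambda>j. if j \<in> D then 1 else 0) i \<le> (real w + 1) * (1 / s + 2 / sqrt (2 * real T + 1))"
proof -
  let ?c = "\<lambda>j. real (2 * T choose j)"
  define X where "X = {j. j \<le> 2 * T \<and> i + j \<in> D}"
  have fin: "finite X" by (simp add: X_def)
  \<comment> \<open>Distinct elements of \<open>D\<close> in the same residue class modulo \<open>w + 1\<close> are more than \<open>s\<close> apart.\<close>
  have class_bound: "sum ?c {j\<in>X. j mod (w + 1) = r} \<le> 4 ^ T * (1 / s + 2 / sqrt (2 * real T + 1))" for r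
  proof -
    have "sum ?c {j\<in>X. j mod (w + 1) = r} \<le> 4 ^ T / s + 2 * ?c T"
    proof (rule sum_choose_separated)
      fix x y assume "x \<in> {j\<in>X. j mod (w + 1) = r}" "y \<in> {j\<in>X. j mod (w + 1) = r}" and xy: "x < y"
      hence x: "i + x \<in> D" "i + y \<in> D" and "x mod (w + 1) = y mod (w + 1)" by (auto simp: X_def)
      hence "w + 1 dvd y - x" using xy by (metis less_imp_le mod_eq_dvd_iff_nat)
      hence "w + 1 \<le> y - x" using xy by (intro dvd_imp_le) auto
      thus "s < y - x" using D[OF x] xy by fastforce
    qed (use fin s in auto)
    also have "?c T \<le> 4 ^ T / sqrt (2 * real T + 1)"
      using central_binomial_upper[of T] by (simp add: pos_le_divide_eq)
    finally show ?thesis by (simp add: algebra_simps)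
  qed
  have "(\<Sum>j\<le>2*T. ?c j * (if i + j \<in> D then 1 else 0)) = sum ?c X"
    by (rule sum.mono_neutral_cong_right) (auto simp: X_def)
  also have "\<dots> = (\<Sum>r\<in>{..<w+1}. sum ?c {j\<in>X. j mod (w + 1) = r})"
    by (rule sum.group[symmetric]) (use fin in auto)
  also have "\<dots> \<le> (\<Sum>r\<in>{..<w+1}. 4 ^ T * (1 / s + 2 / sqrt (2 * real T + 1)))"
    by (intro sum_mono class_bound)
  also have "\<dots> = 4 ^ T * ((real w + 1) * (1 / s + 2 / sqrt (2 * real T + 1)))"
    by (simp add: algebra_simps)
  finally have "(\<Sum>j\<le>2*T. ?c j * (if i + j \<in> D then 1 else 0))
      \<le> 2 ^ (2 * T) * ((real w + 1) * (1 / s + 2 / sqrt (2 * real T + 1)))"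
    by (simp add: power_mult)
  thus ?thesis unfolding bav_eq_sum by (subst pos_divide_le_eq) (simp_all only: zero_less_power zero_less_numeral mult.commute)
qed

lemma bav_tail:
  "bav (2 * (h + q)) (\<lambda>j. if i + 9 * h div 8 < j then 1 else 0) i \<le> 2 ^ q * (1085 / 1093) ^ h"
proof -
  \<comment> \<open>Chernoff bound with weight \<open>(y ^ 8) ^ j\<close>; the eighth power avoids rounding \<open>9 * h / 8\<close>.\<close>
  define y :: real where "y = 101 / 100"
  \<comment> \<open>The factor per row is \<open>((1 + y ^ 8) / 2)\<^sup>2\<close>, and each unit of
    \<open>h\<close> in the threshold gains \<open>y ^ 9\<close>, which is larger. The
    \<open>q\<close> extra rows cost at most \<open>2\<close> each.\<close>
  have y: "y \<ge> 1" "((1 + y ^ 8) / 2)\<^sup>2 \<le> 1085 / 1000" "1093 / 1000 \<le> y ^ 9"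
    by (simp_all add: y_def field_simps)
  have pow: "bav m (\<lambda>j. x ^ j) i = x ^ i * ((1 + x) / 2) ^ m" for m x
  proof (induction m arbitrary: i)
    case (Suc m)
    show ?case by (simp only: bav.simps Suc.IH) (simp add: field_simps)
  qed simp
  have "bav (2 * (h + q)) (\<lambda>j. if i + 9 * h div 8 < j then 1 else 0) i
      \<le> bav (2 * (h + q)) (\<lambda>j. (1 / y ^ (8 * i + 9 * h)) * (y ^ 8) ^ j) i"
  proof (rule bav_mono)
    fix j
    have "y ^ (8 * i + 9 * h) \<le> y ^ (8 * (i + j))" if "i + 9 * h div 8 < i + j"
      using that y(1) by (intro power_increasing) auto
    thus "(if i + 9 * h div 8 < i + j then 1 else 0) \<le> (1 / y ^ (8 * i + 9 * h)) * (y ^ 8) ^ (i + j)"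
      using y(1) by (auto simp: field_simps power_mult[symmetric])
  qed
  also have "\<dots> = ((1 + y ^ 8) / 2) ^ (2 * (h + q)) / (y ^ 9) ^ h"
    using y(1) by (simp only: bav_cmult pow) (simp add: power_add power_mult)
  also have "\<dots> = (((1 + y ^ 8) / 2)\<^sup>2) ^ h * (((1 + y ^ 8) / 2)\<^sup>2) ^ q / (y ^ 9) ^ h"
    by (simp add: power_add power_mult)
  also have "\<dots> \<le> (1085 / 1000) ^ h * 2 ^ q / (1093 / 1000) ^ h"
    using y by (intro frac_le mult_mono power_mono) auto
  also have "\<dots> = 2 ^ q * (1085 / 1093) ^ h"
    using power_divide[of "1085 / 1000 :: real" "1093 / 1000" h] by simp
  finally show ?thesis .
qed

section \<open>Damped random walks\<close>

definition exits :: "(nat \<Rightarrow> nat \<Rightarrow> bool) \<Rightarrow> nat \<Rightarrow> nat \<Rightarrow> nat \<Rightarrow> bool" where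
  "exits bl i k h \<longleftrightarrow> (\<forall>t<h. bl i (k + t)) \<and> \<not> bl i (k + h)"

text \<open>
  The walk moves from \<open>(i, k)\<close> to row \<open>k + 1\<close> by two flips of a fair coin, with \<open>i\<close> counting the
  heads out of \<open>n\<close>. The predicate \<open>bl\<close> marks the black points, where no damping is available;
  \<open>exits bl i k h\<close> says that the maximal black run upwards from \<open>(i, k)\<close> has length \<open>h\<close>, so
  \<open>h = 0\<close> means that \<open>(i, k)\<close> is white.
\<close>

locale damped_walk =
  fixes n :: nat and F :: "nat \<Rightarrow> nat \<Rightarrow> real" and bl :: "nat \<Rightarrow> nat \<Rightarrow> bool" and \<eta> :: real
  assumes \<eta>: "0 < \<eta>" "\<eta> \<le> 1 / 2"
    and F_nonneg: "0 \<le> F i k" and F_le_1: "F i k \<le> 1"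
    and step: "F i k \<le> F i (k + 1) / 4 + F (i + 1) (k + 1) / 2 + F (i + 2) (k + 1) / 4"
    and step_white: "\<not> bl i k \<Longrightarrow>
      F i k \<le> F i (k + 1) / 4 + (1 - 2 * \<eta>) * F (i + 1) (k + 1) / 2 + F (i + 2) (k + 1) / 4"
    and exits_ex: "i < n \<Longrightarrow> \<exists>h. exits bl i k h \<and> 5 * h \<le> 4 * (n - i)"
    and exits_white: "exits bl i k h \<Longrightarrow> (3::nat) ^ d \<le> 4 ^ h \<Longrightarrow> \<not> bl (i + d) (k + h)"
    and separated: "exits bl i k h \<Longrightarrow> i \<le> x \<Longrightarrow> x < y \<Longrightarrow> (3::nat) ^ (x - i) \<le> 4 ^ h \<Longrightarrow>
      (\<And>t. t \<le> s \<Longrightarrow> bl x (k + h + q + t)) \<Longrightarrow> (\<And>t. t \<le> s \<Longrightarrow> bl y (k + h + q + t)) \<Longrightarrow>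
      y - x \<le> s \<Longrightarrow> y - x \<le> 2 * q"
begin

lemma bav_2: "bav 2 f i = f i / 4 + f (i + 1) / 2 + f (i + 2) / 4"
  by (simp add: numeral_2_eq_2 field_simps)

lemma F_le_bav: "F i k \<le> bav (2 * T) (\<lambda>j. F j (k + T)) i"
proof (induction T)
  case (Suc T)
  have "bav (2 * T) (\<lambda>j. F j (k + T)) i \<le> bav (2 * T) (bav 2 (\<lambda>j. F j (k + T + 1))) i"
    by (rule bav_mono) (use step in \<open>simp add: bav_2\<close>)
  also have "\<dots> = bav (2 * Suc T) (\<lambda>j. F j (k + Suc T)) i"
    using bav_add[of "2 * T" 2 "\<lambda>j. F j (k + T + 1)" i] by simp
  finally show ?case using Suc by simp
qed simp

text \<open>
  After \<open>2 * h\<close> flips there are at most \<open>h\<close> heads with probability at least \<open>1/2\<close>, and then the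
  walk is at a white point.
\<close>

lemma gain:
  assumes ex: "exits bl i k h" and \<Lambda>: "0 \<le> \<Lambda>" and Q: "\<And>j. 0 \<le> Q j"
    and F: "\<And>j. j \<le> 2 * h + 2 \<Longrightarrow> F (i + j) (k + h + 1) \<le> \<Lambda> + Q (i + j)"
  shows "F i k \<le> \<Lambda> * (1 - \<eta> / 2) + bav (2 * (h + 1)) Q i"
proof -
  define W :: "nat \<Rightarrow> real" where "W = (\<lambda>j. if j \<le> i + h then 1 else 0)"
  have row: "F (i + j) (k + h) \<le> (\<Lambda> + (- \<Lambda> * \<eta>) * W (i + j)) + bav 2 Q (i + j)" if j: "j \<le> 2 * h" for j
  proof -
    have F': "F (i + j) (k + h + 1) \<le> \<Lambda> + Q (i + j)" "F (i + j + 1) (k + h + 1) \<le> \<Lambda> + Q (i + j + 1)"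
      "F (i + j + 2) (k + h + 1) \<le> \<Lambda> + Q (i + j + 2)"
      using F[of j] F[of "j + 1"] F[of "j + 2"] j by (auto simp: add.assoc)
    show ?thesis
    proof (cases "j \<le> h")
      case True
      have "(3::nat) ^ j \<le> 3 ^ h" using True by (intro power_increasing) auto
      also have "\<dots> \<le> 4 ^ h" by (intro power_mono) auto
      finally have w: "\<not> bl (i + j) (k + h)" by (rule exits_white[OF ex])
      \<comment> \<open>The middle outcome has weight \<open>1 / 2\<close>, so its damping takes
        \<open>\<Lambda> * \<eta>\<close> off. At least half of the mass is at such points, hence
        \<open>\<eta> / 2\<close> in the conclusion.\<close>
      have "(1 - 2 * \<eta>) * F (i + j + 1) (k + h + 1) \<le> (1 - 2 * \<eta>) * (\<Lambda> + Q (i + j + 1))"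
        using F'(2) \<eta> by (intro mult_left_mono) auto
      also have "\<dots> \<le> \<Lambda> - 2 * (\<Lambda> * \<eta>) + Q (i + j + 1)"
        using \<eta> Q[of "i + j + 1"] by (simp add: algebra_simps)
      finally have "F (i + j) (k + h) \<le> \<Lambda> - \<Lambda> * \<eta> + bav 2 Q (i + j)"
        using step_white[OF w] F'(1,3) unfolding bav_2 by linarith
      thus ?thesis using True by (simp add: W_def)
    next
      case False
      thus ?thesis using step[of "i + j" "k + h"] F' by (simp add: W_def bav_2)
    qed
  qed
  have "F i k \<le> bav (2 * h) (\<lambda>j. F j (k + h)) i" by (rule F_le_bav)
  also have "\<dots> \<le> bav (2 * h) (\<lambda>j. (\<Lambda> + (- \<Lambda> * \<eta>) * W j) + bav 2 Q j) i"
    by (rule bav_mono) (rule row)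
  also have "\<dots> = \<Lambda> - \<Lambda> * \<eta> * bav (2 * h) W i + bav (2 * (h + 1)) Q i"
    using bav_add[of "2 * h" 2 Q i] by (simp only: bav_plus bav_cmult bav_const) simp
  also have "\<dots> \<le> \<Lambda> - \<Lambda> * \<eta> * (1 / 2) + bav (2 * (h + 1)) Q i"
    using bav_lower_half[of h i] \<Lambda> \<eta> unfolding W_def
    by (intro add_right_mono diff_left_mono mult_left_mono) auto
  finally show ?thesis by (simp add: algebra_simps)
qed

text \<open>
  The penalty \<open>\<beta> p\<close> is paid at the points of row \<open>k0 + p\<close> from which a white point cannot be reached
  within \<open>s p\<close> rows. Every other round gains the factor \<open>1 - \<eta> / 2\<close>, and \<open>N\<close> rounds end
  before row \<open>k0 + P\<close>.
\<close>

lemma rounds: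
  fixes \<beta> :: "nat \<Rightarrow> nat \<Rightarrow> real" and s :: "nat \<Rightarrow> nat" and P :: nat
  defines "Q \<equiv> \<lambda>p x. \<Sum>q\<in>{p..P}. bav (2 * (q - p)) (\<beta> q) x"
    and "f \<equiv> \<lambda>p. p + s p + 1"
  assumes \<Lambda>: "0 \<le> \<Lambda>" and s: "mono s" and \<beta>: "\<And>p x. 0 \<le> \<beta> p x"
    and alt: "\<And>p x. p \<le> P \<Longrightarrow> F x (k0 + p) \<le> \<Lambda> * \<beta> p x \<or>
      F x (k0 + p) \<le> \<Lambda> \<and> (\<exists>h\<le>s p. exits bl x (k0 + p) h)"
    and N: "(f ^^ N) p \<le> P"
  shows "F x (k0 + p) \<le> \<Lambda> * ((1 - \<eta> / 2) ^ N + Q p x)"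
  using N
proof (induction N arbitrary: p x)
  have Q_nonneg: "0 \<le> Q p x" for p x
    unfolding Q_def by (intro sum_nonneg bav_nonneg \<beta>)
  have Q_ge: "\<beta> p x \<le> Q p x" if "p \<le> P" for p x
  proof -
    have "bav (2 * (p - p)) (\<beta> p) x \<le> Q p x"
      unfolding Q_def by (rule member_le_sum) (use that in \<open>auto intro!: bav_nonneg \<beta>\<close>)
    thus ?thesis by simp
  qed
  \<comment> \<open>\<open>Q p x\<close> is the expected total penalty in rows \<open>p\<close> to
    \<open>P\<close> for the walk from \<open>x\<close>; averaging \<open>Q\<close> at a later row
    only drops nonnegative terms.\<close>
  have Q_step: "bav (2 * T) (Q (p + T)) x \<le> Q p x" for T p x
  proof -
    have "bav (2 * T) (Q (p + T)) x = (\<Sum>q\<in>{p+T..P}. bav (2 * T) (bav (2 * (q - (p + T))) (\<beta> q)) x)"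
      unfolding Q_def by (rule bav_sum) simp
    also have "\<dots> = (\<Sum>q\<in>{p+T..P}. bav (2 * (q - p)) (\<beta> q) x)"
    proof (rule sum.cong)
      fix q assume "q \<in> {p + T..P}"
      hence "2 * (q - p) = 2 * T + 2 * (q - (p + T))" by auto
      thus "bav (2 * T) (bav (2 * (q - (p + T))) (\<beta> q)) x = bav (2 * (q - p)) (\<beta> q) x"
        by (simp only: bav_add)
    qed simp
    also have "\<dots> \<le> Q p x"
      unfolding Q_def by (rule sum_mono2) (auto intro!: bav_nonneg \<beta>)
    finally show ?thesis .
  qed
  have bad: "F x (k0 + p) \<le> \<Lambda> * (c + Q p x)" if "F x (k0 + p) \<le> \<Lambda> * \<beta> p x" "p \<le> P" "0 \<le> c" for p x c
    using that Q_ge[of p x] \<Lambda> mult_left_mono[of "\<beta> p x" "c + Q p x" \<Lambda>] by linarith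
  {
    case 0
    thus ?case using alt[of p x] bad[of x p 1] Q_nonneg[of p x] \<Lambda> by (auto simp: distrib_left intro: order_trans)
  next
    case (Suc N)
    have mono_f: "mono f" using s by (auto simp: f_def mono_def intro!: add_mono)
    have le_funpow: "p \<le> (f ^^ m) p" for m p
    proof (induction m)
      case (Suc m)
      have "(f ^^ m) p \<le> f ((f ^^ m) p)" by (simp add: f_def)
      thus ?case using Suc by simp
    qed simp
    have fN: "(f ^^ N) (f p) \<le> P" using Suc.prems by (simp add: funpow_swap1)
    have pP: "p \<le> P" using le_funpow[of p "Suc N"] Suc.prems by simp
    have \<rho>: "0 \<le> (1 - \<eta> / 2) ^ m" for m using \<eta> by (intro zero_le_power) auto
    from alt[OF pP, of x] show ?case
    proof
      assume "F x (k0 + p) \<le> \<Lambda> * \<beta> p x"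
      thus ?thesis using pP \<rho> by (rule bad)
    next
      assume "F x (k0 + p) \<le> \<Lambda> \<and> (\<exists>h\<le>s p. exits bl x (k0 + p) h)"
      then obtain h where h: "h \<le> s p" "exits bl x (k0 + p) h" by blast
      \<comment> \<open>An early exit starts the next round before \<open>f p\<close>; by
        monotonicity the remaining rounds still end by \<open>P\<close>.\<close>
      have "(f ^^ N) (p + (h + 1)) \<le> (f ^^ N) (f p)"
        by (rule monoD[OF mono_pow[OF mono_f]]) (use h in \<open>auto simp: f_def\<close>)
      hence IH: "F y (k0 + (p + (h + 1))) \<le> \<Lambda> * ((1 - \<eta> / 2) ^ N + Q (p + (h + 1)) y)" for y
        using fN by (intro Suc.IH) simp
      have "F x (k0 + p) \<le> \<Lambda> * (1 - \<eta> / 2) ^ N * (1 - \<eta> / 2) + bav (2 * (h + 1)) (\<lambda>y. \<Lambda> * Q (p + (h + 1)) y) x"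
        by (rule gain[OF h(2)]) (use IH \<Lambda> \<rho> Q_nonneg in \<open>auto simp: algebra_simps\<close>)
      also have "bav (2 * (h + 1)) (\<lambda>y. \<Lambda> * Q (p + (h + 1)) y) x \<le> \<Lambda> * Q p x"
        unfolding bav_cmult using Q_step \<Lambda> by (intro mult_left_mono)
      finally show ?thesis by (simp add: algebra_simps)
    qed
  }
qed

end

text \<open>From \<open>3 ^ 9 \<le> 4 ^ 8\<close>. The exit row thus stays white up to
  \<open>9 * h div 8\<close> heads, beyond the mean \<open>h\<close>, which is what makes the tail
  bound effective.\<close>

lemma three_four_power: "(3::nat) ^ (9 * h div 8) \<le> 4 ^ h"
proof -
  have "((3::nat) ^ (9 * h div 8)) ^ 8 = 3 ^ (9 * h div 8 * 8)"
    by (simp only: power_mult)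
  also have "\<dots> \<le> 3 ^ (9 * h)"
    by (intro power_increasing) auto
  also have "\<dots> = (3 ^ 9) ^ h" by (simp only: power_mult)
  also have "\<dots> \<le> (4 ^ 8) ^ h" by (intro power_mono) auto
  also have "\<dots> = (4 ^ h) ^ 8" by (simp only: power_mult[symmetric] mult.commute)
  finally show ?thesis by (rule power_le_imp_le_base[of _ 7, simplified]) simp
qed

context damped_walk begin

lemma short_block:
  assumes "exits bl i k h" "0 \<le> \<Lambda>" "\<And>j. j \<le> 2 * h + 2 \<Longrightarrow> F (i + j) (k + h + 1) \<le> \<Lambda>"
  shows "F i k \<le> \<Lambda> * (1 - \<eta> / 2)"
  using gain[OF assms(1,2), of "\<lambda>_. 0"] assms(3) by simp

text \<open>Meant for \<open>h\<close> comparable with \<open>n - i\<close>: the loss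
  \<open>10 powr A\<close> is to be won back by \<open>N\<close> rounds. The first sum bounds the
  chance of meeting a cluster, the second one pays for walks with too many heads.\<close>

lemma long_block:
  fixes A B :: real and S P N :: nat
  assumes A: "0 \<le> A" and B: "1 \<le> B" and F_bound: "\<And>i k. i < n \<Longrightarrow> F i k \<le> B * real (n - i) powr (- A)"
    and i: "i < n" and ex: "exits bl i k h" and h: "5 * h \<le> 4 * (n - i)" and S: "1 \<le> S"
    and N: "((\<lambda>p. p + S * (p + 1) ^ 3 + 1) ^^ N) 0 \<le> P"
  shows "F i k \<le> B * (10 powr A * real (n - i) powr (- A) * ((1 - \<eta> / 2) ^ N +
      (\<Sum>q\<le>P. (2 * real q + 1) * (1 / (S * (real q + 1) ^ 3) + 2 / sqrt (2 * real h + 1))))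
      + (\<Sum>q\<le>P. 2 ^ q * (1085 / 1093) ^ h))"
proof -
  \<comment> \<open>Leaving the black run costs \<open>h\<close> rows with about \<open>h\<close> heads, so more than \<open>9 * h / 8\<close> heads
    are exponentially unlikely, whereas \<open>imax\<close> still leaves a tenth of the remaining heads.\<close>
  define imax where "imax = i + 9 * h div 8"
  define \<Lambda> where "\<Lambda> = B * real (n - imax) powr (- A)"
  define s where "s = (\<lambda>p. S * (p + 1) ^ 3)"
  define bad where "bad = (\<lambda>q. {x. i \<le> x \<and> x \<le> imax \<and> (\<forall>t\<le>s q. bl x (k + h + q + t))})"
  \<comment> \<open>Beyond \<open>imax\<close> only \<open>F \<le> 1\<close> is available, and
    \<open>\<Lambda> * (B / \<Lambda>) = B\<close> dominates it. The value at \<open>x < i\<close>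
    is harmless because the walk from \<open>i\<close> never goes there.\<close>
  define \<beta> where "\<beta> = (\<lambda>q x. if imax < x then B / \<Lambda> else if x < i \<or> x \<in> bad q then 1 else 0)"
  have imax: "imax < n" and room: "real (n - i) \<le> 10 * real (n - imax)"
    using h i by (auto simp: imax_def)
  have \<Lambda>: "0 < \<Lambda>" using imax B by (simp add: \<Lambda>_def)
  have B\<Lambda>: "0 \<le> B / \<Lambda>" using \<Lambda> B by simp
  have F_\<Lambda>: "F x k' \<le> \<Lambda>" if "x \<le> imax" for x k'
  proof -
    have "F x k' \<le> B * real (n - x) powr (- A)" using that imax by (intro F_bound) simp
    also have "\<dots> \<le> \<Lambda>" unfolding \<Lambda>_def using that imax B A by (intro mult_left_mono powr_mono2') auto
    finally show ?thesis .
  qed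
  have "F x (k + h + p) \<le> \<Lambda> * ((1 - \<eta> / 2) ^ N + (\<Sum>q\<in>{p..P}. bav (2 * (q - p)) (\<beta> q) x))"
    if "((\<lambda>p. p + s p + 1) ^^ N) p \<le> P" for p x
  proof (rule rounds[OF _ _ _ _ that])
    show "mono s" by (auto simp: s_def mono_def intro!: power_mono)
    show "0 \<le> \<beta> p x" for p x using B\<Lambda> by (simp add: \<beta>_def)
    show "F x (k + h + p) \<le> \<Lambda> * \<beta> p x \<or>
      F x (k + h + p) \<le> \<Lambda> \<and> (\<exists>h'\<le>s p. exits bl x (k + h + p) h')" if "p \<le> P" for p x
    proof (cases "x \<le> imax")
      case True
      show ?thesis
      proof (cases "x < i \<or> x \<in> bad p")
        case True
        thus ?thesis using F_\<Lambda>[OF \<open>x \<le> imax\<close>] \<open>x \<le> imax\<close> by (simp add: \<beta>_def)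
      next
        case False
        obtain h' where h': "exits bl x (k + h + p) h'" using exits_ex[of x] True imax by (meson le_less_trans)
        have "h' \<le> s p"
        proof (rule ccontr)
          assume "\<not> h' \<le> s p"
          hence "x \<in> bad p" using h' False True by (auto simp: bad_def exits_def)
          thus False using False by simp
        qed
        thus ?thesis using h' F_\<Lambda>[OF True] by blast
      qed
    next
      case False
      thus ?thesis using F_le_1[of x "k + h + p"] B \<Lambda> by (simp add: \<beta>_def)
    qed
  qed (use \<Lambda> in auto)
  from this[of 0] have round: "F x (k + h) \<le> \<Lambda> * (1 - \<eta> / 2) ^ N + \<Lambda> * (\<Sum>q\<in>{..P}. bav (2 * q) (\<beta> q) x)" for x
    using N by (simp add: s_def distrib_left atLeast0AtMost)
  have "bav (2 * (h + q)) (\<beta> q) i \<le> (2 * real q + 1) * (1 / s q + 2 / sqrt (2 * real (h + q) + 1))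
      + B / \<Lambda> * (2 ^ q * (1085 / 1093) ^ h)" for q
  proof -
    have "bav (2 * (h + q)) (\<beta> q) i \<le> bav (2 * (h + q)) (\<lambda>j. (if j \<in> bad q then 1 else 0)
        + B / \<Lambda> * (if imax < j then 1 else 0)) i"
      by (rule bav_mono) (auto simp: \<beta>_def bad_def)
    also have "\<dots> = bav (2 * (h + q)) (\<lambda>j. if j \<in> bad q then 1 else 0) i
        + B / \<Lambda> * bav (2 * (h + q)) (\<lambda>j. if imax < j then 1 else 0) i"
      by (simp only: bav_plus bav_cmult)
    also have "\<dots> \<le> (real (2 * q) + 1) * (1 / s q + 2 / sqrt (2 * real (h + q) + 1))
        + B / \<Lambda> * (2 ^ q * (1085 / 1093) ^ h)"
    proof (intro add_mono mult_left_mono[OF _ B\<Lambda>])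
      show "bav (2 * (h + q)) (\<lambda>j. if j \<in> bad q then 1 else 0) i
          \<le> (real (2 * q) + 1) * (1 / s q + 2 / sqrt (2 * real (h + q) + 1))"
      proof (rule bav_clustered)
        fix x y assume xy: "x \<in> bad q" "y \<in> bad q" "x < y" "y - x \<le> s q"
        have "(3::nat) ^ (x - i) \<le> 3 ^ (9 * h div 8)"
          using xy by (intro power_increasing) (auto simp: bad_def imax_def)
        also note three_four_power
        finally show "y - x \<le> 2 * q"
          using xy by (intro separated[OF ex, of x y "s q" q]) (auto simp: bad_def)
      qed (use S in \<open>simp add: s_def\<close>)
      show "bav (2 * (h + q)) (\<lambda>j. if imax < j then 1 else 0) i \<le> 2 ^ q * (1085 / 1093) ^ h"
        unfolding imax_def by (rule bav_tail)
    qed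
    finally show ?thesis by simp
  qed
  note bav_\<beta> = this
  have "F i k \<le> bav (2 * h) (\<lambda>x. F x (k + h)) i" by (rule F_le_bav)
  also have "\<dots> \<le> bav (2 * h) (\<lambda>x. \<Lambda> * (1 - \<eta> / 2) ^ N + \<Lambda> * (\<Sum>q\<in>{..P}. bav (2 * q) (\<beta> q) x)) i"
    by (rule bav_mono) (rule round)
  also have "\<dots> = \<Lambda> * (1 - \<eta> / 2) ^ N + \<Lambda> * (\<Sum>q\<le>P. bav (2 * h) (bav (2 * q) (\<beta> q)) i)"
    by (simp only: bav_plus bav_cmult bav_const bav_sum finite_atMost)
  also have "\<dots> = \<Lambda> * (1 - \<eta> / 2) ^ N + \<Lambda> * (\<Sum>q\<le>P. bav (2 * (h + q)) (\<beta> q) i)"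
    by (simp only: bav_add[symmetric] distrib_left)
  also have "\<dots> \<le> \<Lambda> * (1 - \<eta> / 2) ^ N + \<Lambda> * (\<Sum>q\<le>P. (2 * real q + 1) * (1 / (S * (real q + 1) ^ 3)
      + 2 / sqrt (2 * real h + 1)) + B / \<Lambda> * (2 ^ q * (1085 / 1093) ^ h))"
  proof (intro add_left_mono mult_left_mono sum_mono)
    fix q
    have sq: "real (s q) = S * (real q + 1) ^ 3" by (simp add: s_def add.commute)
    have "(2 * real q + 1) * (1 / s q + 2 / sqrt (2 * real (h + q) + 1))
      \<le> (2 * real q + 1) * (1 / (S * (real q + 1) ^ 3) + 2 / sqrt (2 * real h + 1))"
      unfolding sq by (intro mult_left_mono add_left_mono divide_left_mono real_sqrt_le_mono) auto
    thus "bav (2 * (h + q)) (\<beta> q) i \<le> (2 * real q + 1) * (1 / (S * (real q + 1) ^ 3)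
      + 2 / sqrt (2 * real h + 1)) + B / \<Lambda> * (2 ^ q * (1085 / 1093) ^ h)"
      using bav_\<beta>[of q] by linarith
  qed (use \<Lambda> in auto)
  also have "\<dots> = \<Lambda> * ((1 - \<eta> / 2) ^ N + (\<Sum>q\<le>P. (2 * real q + 1) * (1 / (S * (real q + 1) ^ 3)
      + 2 / sqrt (2 * real h + 1)))) + B * (\<Sum>q\<le>P. 2 ^ q * (1085 / 1093) ^ h)"
    using \<Lambda> by (simp only: sum.distrib sum_distrib_left[symmetric] distrib_left) simp
  also have "\<dots> \<le> (B * (10 powr A * real (n - i) powr (- A))) * ((1 - \<eta> / 2) ^ N
      + (\<Sum>q\<le>P. (2 * real q + 1) * (1 / (S * (real q + 1) ^ 3)
      + 2 / sqrt (2 * real h + 1)))) + B * (\<Sum>q\<le>P. 2 ^ q * (1085 / 1093) ^ h)"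
  proof (intro add_right_mono mult_right_mono)
    have "real (n - imax) powr (- A) \<le> (real (n - i) / 10) powr (- A)"
      using room A i by (intro powr_mono2') auto
    also have "\<dots> = 10 powr A * real (n - i) powr (- A)"
      using i by (simp add: powr_divide powr_minus field_simps)
    finally show "\<Lambda> \<le> B * (10 powr A * real (n - i) powr (- A))"
      unfolding \<Lambda>_def using B by (intro mult_left_mono) auto
    show "0 \<le> (1 - \<eta> / 2) ^ N + (\<Sum>q\<le>P. (2 * real q + 1) * (1 / (S * (real q + 1) ^ 3)
      + 2 / sqrt (2 * real h + 1)))"
      using \<eta> by (intro add_nonneg_nonneg sum_nonneg zero_le_power mult_nonneg_nonneg) auto
  qed
  finally show ?thesis by (simp only: distrib_left mult.assoc)
qed

end

section \<open>Choice of constants and bootstrap of the decay rate\<close>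

lemma sum_cluster_weights: "(\<Sum>q\<le>P. (2 * real q + 1) / (real q + 1) ^ 3) \<le> 4 - 2 / (real P + 1)"
proof (induction P)
  case (Suc P)
  \<comment> \<open>The upper bound telescopes, so the subtracted term in the statement carries the
    induction.\<close>
  have "(2 * real (Suc P) + 1) / (real (Suc P) + 1) ^ 3 \<le> 2 / (real P + 1) - 2 / (real (Suc P) + 1)"
  proof -
    have "(2 * x + 1) / (x + 1) ^ 3 \<le> 2 / x - 2 / (x + 1)" if "x > 0" for x :: real
    proof -
      have "(2 * x + 1) / (x + 1) ^ 3 \<le> (2 * (x + 1)) / (x + 1) ^ 3"
        using that by (intro divide_right_mono) auto
      also have "\<dots> = 2 / (x + 1)\<^sup>2"
        using that by (simp add: power3_eq_cube power2_eq_square divide_simps)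
      also have "\<dots> \<le> 2 / (x * (x + 1))"
        using that by (intro divide_left_mono) (auto simp: power2_eq_square)
      also have "\<dots> = 2 / x - 2 / (x + 1)"
        using that by (simp add: field_simps)
      finally show ?thesis .
    qed
    from this[of "real (Suc P)"] show ?thesis by (simp add: add.commute)
  qed
  thus ?case using Suc by simp
qed simp

text \<open>By continuity at \<open>\<delta> = 0\<close>: using up a small fraction of the missing
  heads costs less than one gain.\<close>

lemma short_constant:
  fixes A \<eta> :: real
  assumes "0 < \<eta>"
  shows "\<exists>\<delta>. 0 < \<delta> \<and> \<delta> < 1 \<and> (1 - \<delta>) powr (- A) * (1 - \<eta> / 2) \<le> 1 - \<eta> / 4"
proof -
  have "((\<lambda>\<delta>. (1 - \<delta>) powr (- A) * (1 - \<eta> / 2)) \<longlongrightarrow> (1 - 0) powr (- A) * (1 - \<eta> / 2)) (at_right 0)"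
    by (intro tendsto_intros) auto
  moreover have "(1 - 0) powr (- A) * (1 - \<eta> / 2) < 1 - \<eta> / 4" using assms by simp
  ultimately have "eventually (\<lambda>\<delta>. (1 - \<delta>) powr (- A) * (1 - \<eta> / 2) < 1 - \<eta> / 4) (at_right 0)"
    by (rule order_tendstoD)
  moreover have "eventually (\<lambda>\<delta>. \<delta> \<in> {0<..<1::real}) (at_right 0)"
    by (rule eventually_at_right_real) simp
  ultimately have "eventually (\<lambda>\<delta>. 0 < \<delta> \<and> \<delta> < 1 \<and> (1 - \<delta>) powr (- A) * (1 - \<eta> / 2) \<le> 1 - \<eta> / 4) (at_right 0)"
    by eventually_elim auto
  thus ?thesis using eventually_happens by force
qed

text \<open>For runs of length at least \<open>\<delta> * r / 2 - 1\<close> the central coefficient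
  contributes \<open>O(1 / sqrt r)\<close>, and the exponential tail beats
  \<open>r powr A\<close>.\<close>

lemma long_constant:
  fixes A \<delta> C1 C2 \<kappa> :: real
  assumes "0 < \<delta>" "0 < \<kappa>" "\<kappa> < 1"
  shows "eventually (\<lambda>r::nat. C1 * (2 / sqrt (\<delta> * real r - 1)) \<le> 1 / 8 \<and>
    real r powr A * (C2 * \<kappa> powr (\<delta> * real r / 2 - 1)) \<le> 1 / 8) at_top"
proof -
  have "((\<lambda>r::nat. C1 * (2 / sqrt (\<delta> * real r - 1))) \<longlongrightarrow> 0) at_top"
    using assms(1) by real_asymp
  moreover have "((\<lambda>r::nat. real r powr A * (C2 * \<kappa> powr (\<delta> * real r / 2 - 1))) \<longlongrightarrow> 0) at_top"
  proof -
    define c where "c = - ln \<kappa>"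
    have c: "0 < c" using assms by (simp add: c_def)
    have "((\<lambda>r::nat. real r powr A * (C2 * exp (- c * (\<delta> * real r / 2 - 1)))) \<longlongrightarrow> 0) at_top"
      using assms(1) c by real_asymp
    thus ?thesis using assms(2) by (simp add: powr_def c_def mult.commute)
  qed
  ultimately show ?thesis
    by (intro eventually_conj; drule_tac a = "1 / 8" in order_tendstoD(2)) (auto elim: eventually_mono)
qed

text \<open>Runs using at most a fraction \<open>\<delta>\<close> of the missing heads are handled
  by \<open>short_block\<close>, the others by \<open>long_block\<close>. \<open>R\<close> is
  uniform in the walk and in \<open>B\<close>, as the bootstrap requires.\<close>

lemma damped_walk_improve:
  fixes A \<eta> :: real
  assumes A: "0 < A" and \<eta>: "0 < \<eta>" "\<eta> \<le> 1 / 2"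
  shows "\<exists>R\<ge>1. \<forall>n F bl B i k. damped_walk n F bl \<eta> \<longrightarrow> 1 \<le> B \<longrightarrow>
    (\<forall>i k. i < n \<longrightarrow> F i k \<le> B * real (n - i) powr (- A)) \<longrightarrow> i < n \<longrightarrow> R \<le> n - i \<longrightarrow>
    F i k \<le> (1 - \<eta> / 4) * B * real (n - i) powr (- A)"
proof -
  obtain \<delta> where \<delta>: "0 < \<delta>" "\<delta> < 1" "(1 - \<delta>) powr (- A) * (1 - \<eta> / 2) \<le> 1 - \<eta> / 4"
    using short_constant[OF \<eta>(1)] by blast
  define c where "c = (10::real) powr A"
  have c: "0 < c" by (simp add: c_def)
  have "(\<lambda>N. c * (1 - \<eta> / 2) ^ N) \<longlonglongrightarrow> c * 0"
    using \<eta> by (intro tendsto_intros LIMSEQ_realpow_zero) auto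
  hence "eventually (\<lambda>N. c * (1 - \<eta> / 2) ^ N < 1 / 8) at_top"
    by (rule order_tendstoD) simp
  then obtain N where N: "c * (1 - \<eta> / 2) ^ N < 1 / 8"
    by (auto simp: eventually_at_top_linorder)
  \<comment> \<open>With \<open>32 * c \<le> S\<close>, the bound \<open>4\<close> on the cluster
    weights contributes at most \<open>1 / 8\<close>.\<close>
  obtain S0 :: nat where S0: "32 * c \<le> S0" using real_arch_simple by blast
  \<comment> \<open>The order of choices matters: \<open>P\<close> depends on \<open>S\<close> and \<open>N\<close>, hence the sum of the cluster weights must
    be bounded independently of \<open>P\<close>; the remaining terms vanish as \<open>r\<close> grows with \<open>P\<close> fixed.\<close>
  define S where "S = Suc S0"
  have S: "1 \<le> S" "32 * c \<le> S" using S0 by (auto simp: S_def)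
  define P where "P = ((\<lambda>p. p + S * (p + 1) ^ 3 + 1) ^^ N) 0"
  define C1 where "C1 = c * (\<Sum>q\<le>P. 2 * real q + 1)"
  define C2 where "C2 = (\<Sum>q\<le>P. (2::real) ^ q)"
  define \<kappa> where "\<kappa> = (1085 / 1093 :: real)"
  have "eventually (\<lambda>r::nat. 2 \<le> \<delta> * real r) at_top"
    using \<delta>(1) by real_asymp
  with long_constant[of \<delta> \<kappa> C1 A C2] \<delta>(1)
  have "eventually (\<lambda>r::nat. 2 \<le> \<delta> * real r \<and> C1 * (2 / sqrt (\<delta> * real r - 1)) \<le> 1 / 8 \<and>
      real r powr A * (C2 * \<kappa> powr (\<delta> * real r / 2 - 1)) \<le> 1 / 8) at_top"
    by (simp add: \<kappa>_def eventually_conj_iff)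
  then obtain R0 where R0: "2 \<le> \<delta> * real r" "C1 * (2 / sqrt (\<delta> * real r - 1)) \<le> 1 / 8"
      "real r powr A * (C2 * \<kappa> powr (\<delta> * real r / 2 - 1)) \<le> 1 / 8" if "R0 \<le> r" for r :: nat
    by (auto simp: eventually_at_top_linorder)
  show ?thesis
  proof (intro exI[of _ "max 1 R0"] conjI allI impI)
    fix n F bl B i k
    assume dw: "damped_walk n F bl \<eta>" and B: "1 \<le> (B::real)" and i: "i < n" and R: "max 1 R0 \<le> n - i"
      and F_bound: "\<forall>i k. i < n \<longrightarrow> F i k \<le> B * real (n - i) powr (- A)"
    interpret damped_walk n F bl \<eta> by (rule dw)
    define r where "r = real (n - i)"
    have r: "1 \<le> r" using i by (simp add: r_def)
    note R0 = R0[of "n - i", folded r_def]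
    obtain h where ex: "exits bl i k h" and h: "5 * h \<le> 4 * (n - i)" using exits_ex[OF i] by blast
    have B_nonneg: "0 \<le> B * r powr (- A)" using B by simp
    show "F i k \<le> (1 - \<eta> / 4) * B * real (n - i) powr (- A)"
    proof (cases "2 * real h + 2 \<le> \<delta> * r")
      case True
      define \<Lambda> where "\<Lambda> = B * ((1 - \<delta>) * r) powr (- A)"
      have pos: "0 < (1 - \<delta>) * r" using \<delta> r by simp
      have "F i k \<le> \<Lambda> * (1 - \<eta> / 2)"
      proof (rule short_block[OF ex])
        show "0 \<le> \<Lambda>" using B by (simp add: \<Lambda>_def)
        fix j assume j: "j \<le> 2 * h + 2"
        have "\<delta> * r < 1 * r" using \<delta> r by (intro mult_strict_right_mono) auto
        hence "real (2 * h + 2) < r" using True by simp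
        hence lt: "2 * h + 2 < n - i" unfolding r_def of_nat_less_iff .
        hence "i + j < n" using j by simp
        hence "F (i + j) (k + h + 1) \<le> B * real (n - (i + j)) powr (- A)" using F_bound by blast
        also have "\<dots> \<le> \<Lambda>" unfolding \<Lambda>_def
        proof (intro mult_left_mono powr_mono2')
          have "real (n - (i + j)) = r - real j" using lt j by (simp add: r_def of_nat_diff)
          thus "(1 - \<delta>) * r \<le> real (n - (i + j))" using True j by (simp add: algebra_simps)
        qed (use A B pos in auto)
        finally show "F (i + j) (k + h + 1) \<le> \<Lambda>" .
      qed
      also have "\<dots> = B * r powr (- A) * ((1 - \<delta>) powr (- A) * (1 - \<eta> / 2))"
        using \<delta> r by (simp add: \<Lambda>_def powr_mult)
      also have "\<dots> \<le> B * r powr (- A) * (1 - \<eta> / 4)"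
        using \<delta>(3) B_nonneg by (rule mult_left_mono)
      finally show ?thesis by (simp add: r_def mult_ac)
    next
      case False
      have rA: "r powr (- A) * r powr A = 1" using r by (simp add: powr_add[symmetric])
      have hr: "\<delta> * r - 1 \<le> 2 * real h + 1" "\<delta> * r / 2 - 1 \<le> real h" using False by auto
      have "c * (\<Sum>q\<le>P. a q * (1 / (S * b q) + y)) = c / S * (\<Sum>q\<le>P. a q / b q) + c * (\<Sum>q\<le>P. a q) * y"
        for a b :: "nat \<Rightarrow> real" and y
        by (simp add: distrib_left sum.distrib sum_distrib_left sum_distrib_right mult_ac)
      hence "c * (\<Sum>q\<le>P. (2 * real q + 1) * (1 / (S * (real q + 1) ^ 3) + 2 / sqrt (2 * real h + 1)))
          = c / S * (\<Sum>q\<le>P. (2 * real q + 1) / (real q + 1) ^ 3) + C1 * (2 / sqrt (2 * real h + 1))"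
        unfolding C1_def .
      also have "\<dots> \<le> c / S * 4 + C1 * (2 / sqrt (\<delta> * r - 1))"
      proof (intro add_mono mult_left_mono)
        have "0 \<le> 2 / (real P + 1)" by simp
        thus "(\<Sum>q\<le>P. (2 * real q + 1) / (real q + 1) ^ 3) \<le> 4"
          using sum_cluster_weights[of P] by linarith
        show "2 / sqrt (2 * real h + 1) \<le> 2 / sqrt (\<delta> * r - 1)"
          using hr(1) R0(1) R by (intro divide_left_mono real_sqrt_le_mono mult_pos_pos) auto
      qed (use c in \<open>auto simp: C1_def intro!: mult_nonneg_nonneg sum_nonneg\<close>)
      also have "\<dots> \<le> 1 / 8 + 1 / 8"
        using S R0(2) R by (intro add_mono) (auto simp: field_simps)
      finally have main: "c * (\<Sum>q\<le>P. (2 * real q + 1) * (1 / (S * (real q + 1) ^ 3) + 2 / sqrt (2 * real h + 1))) \<le> 1 / 4"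
        by simp
      have "r powr A * (\<Sum>q\<le>P. 2 ^ q * \<kappa> ^ h) = r powr A * (C2 * \<kappa> powr real h)"
        by (simp add: C2_def sum_distrib_right powr_realpow \<kappa>_def)
      also have "\<dots> \<le> r powr A * (C2 * \<kappa> powr (\<delta> * r / 2 - 1))"
        using hr(2) by (intro mult_left_mono powr_mono') (auto simp: \<kappa>_def C2_def intro!: sum_nonneg)
      finally have tail: "r powr A * (\<Sum>q\<le>P. 2 ^ q * \<kappa> ^ h) \<le> 1 / 8"
        using R0(3) R by linarith
      have "F i k \<le> B * (c * r powr (- A) * ((1 - \<eta> / 2) ^ N +
          (\<Sum>q\<le>P. (2 * real q + 1) * (1 / (S * (real q + 1) ^ 3) + 2 / sqrt (2 * real h + 1))))
          + (\<Sum>q\<le>P. 2 ^ q * \<kappa> ^ h))"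
        unfolding c_def r_def \<kappa>_def
        by (rule long_block[OF _ B _ i ex h S(1)]) (use A F_bound in \<open>auto simp: P_def\<close>)
      also have "\<dots> = B * r powr (- A) * (c * (1 - \<eta> / 2) ^ N
          + c * (\<Sum>q\<le>P. (2 * real q + 1) * (1 / (S * (real q + 1) ^ 3) + 2 / sqrt (2 * real h + 1)))
          + r powr A * (\<Sum>q\<le>P. 2 ^ q * \<kappa> ^ h))"
      proof -
        have "B * (c * y * (a + b) + d) = B * y * (c * a + c * b + z * d)" if "y * z = 1" for y z a b d :: real
        proof -
          have "B * y * (c * a + c * b + z * d) = B * (c * y * (a + b)) + B * (y * z) * d"
            by (simp add: algebra_simps)
          thus ?thesis using that by (simp add: algebra_simps)
        qed
        thus ?thesis using rA by blast
      qed
      \<comment> \<open>The shares \<open>1 / 8\<close>, \<open>1 / 4\<close> and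
        \<open>1 / 8\<close> add up to \<open>1 / 2\<close>, which is below
        \<open>1 - \<eta> / 4\<close>.\<close>
      also have "\<dots> \<le> B * r powr (- A) * (1 - \<eta> / 4)"
        using N main tail \<eta> B_nonneg by (intro mult_left_mono) auto
      finally show ?thesis by (simp add: r_def mult_ac)
    qed
  qed simp
qed

text \<open>The supremum of \<open>F i k * (n - i) powr A\<close> is finite, as
  \<open>F \<le> 1\<close>. Were it above \<open>M\<close>, the improvement for
  \<open>R \<le> n - i\<close> would push it strictly below itself; the other points give at most
  \<open>M\<close>.\<close>

lemma damped_walk_decay:
  fixes A \<eta> :: real
  assumes A: "0 < A" and \<eta>: "0 < \<eta>" "\<eta> \<le> 1 / 2"
  shows "\<exists>C. \<forall>n F bl. 1 \<le> n \<longrightarrow> damped_walk n F bl \<eta> \<longrightarrow> F 0 0 \<le> C * real n powr (- A)"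
proof -
  obtain R where R: "1 \<le> R" and improve: "\<And>n F bl B i k. damped_walk n F bl \<eta> \<Longrightarrow> 1 \<le> B \<Longrightarrow>
    (\<And>i k. i < n \<Longrightarrow> F i k \<le> B * real (n - i) powr (- A)) \<Longrightarrow> i < n \<Longrightarrow> R \<le> n - i \<Longrightarrow>
    F i k \<le> (1 - \<eta> / 4) * B * real (n - i) powr (- A)"
    using damped_walk_improve[OF assms] by meson
  define M where "M = real R powr A"
  have M: "1 \<le> M" unfolding M_def using R A by (intro ge_one_powr_ge_zero) auto
  show ?thesis
  proof (intro exI[of _ M] allI impI)
    fix n :: nat and F bl assume n: "1 \<le> n" and dw: "damped_walk n F bl \<eta>"
    interpret damped_walk n F bl \<eta> by (rule dw)
    define f where "f = (\<lambda>(i, k). F i k * real (n - i) powr A)"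
    define X where "X = f ` ({..<n} \<times> UNIV)"
    define B where "B = max M (Sup X)"
    have mult_inv: "F i k \<le> b * real (n - i) powr (- A) \<longleftrightarrow> f (i, k) \<le> b" if "i < n" for i k b
      using that by (simp add: f_def powr_minus field_simps)
    have f_le: "f (i, k) \<le> real (n - i) powr A" for i k
      unfolding f_def using F_le_1[of i k] by (simp add: mult_left_le_one_le F_nonneg)
    have "f (i, k) \<le> real n powr A" if "i < n" for i k
    proof -
      have "real (n - i) powr A \<le> real n powr A" using A by (intro powr_mono2) auto
      thus ?thesis using f_le[of i k] by linarith
    qed
    hence bdd: "bdd_above X" by (auto simp: X_def intro!: bdd_aboveI[of _ "real n powr A"])
    have "f (0, 0) \<in> X" unfolding X_def using n by (intro imageI) auto
    hence ne: "X \<noteq> {}" by blast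
    have f_Sup: "f (i, k) \<le> Sup X" if "i < n" for i k
      using that bdd by (intro cSup_upper) (auto simp: X_def)
    have F_bound: "F i k \<le> B * real (n - i) powr (- A)" if "i < n" for i k
      using f_Sup[OF that, of k] by (subst mult_inv[OF that]) (simp add: B_def)
    have "Sup X \<le> max M ((1 - \<eta> / 4) * B)"
    proof (rule cSup_least[OF ne])
      fix x assume "x \<in> X"
      then obtain i k where x: "x = f (i, k)" and i: "i < n" by (auto simp: X_def)
      show "x \<le> max M ((1 - \<eta> / 4) * B)"
      proof (cases "R \<le> n - i")
        case True
        have "F i k \<le> (1 - \<eta> / 4) * B * real (n - i) powr (- A)"
          using M by (intro improve[OF dw _ F_bound i True]) (auto simp: B_def)
        thus ?thesis unfolding x by (subst (asm) mult_inv[OF i]) simp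
      next
        case False
        have "real (n - i) powr A \<le> M" unfolding M_def using False A by (intro powr_mono2) auto
        thus ?thesis unfolding x using f_le[of i k] by simp
      qed
    qed
    moreover have "0 < B" using M by (simp add: B_def)
    hence "(1 - \<eta> / 4) * B < B" using \<eta> by (simp add: algebra_simps)
    ultimately have "Sup X \<le> M" by (auto simp: B_def max_def split: if_splits)
    hence "f (0, 0) \<le> M" using f_Sup[of 0 0] n by simp
    thus "F 0 0 \<le> M * real n powr (- A)" using mult_inv[of 0 0 M] n by simp
  qed
qed

section \<open>The geometry of the black points\<close>

text \<open>The residue of \<open>x\<close> of least absolute value, for odd \<open>N\<close>.\<close>

definition cres :: "int \<Rightarrow> int \<Rightarrow> int" where
  "cres N x = (x + N div 2) mod N - N div 2"

lemma cres_cong: "[cres N x = x] (mod N)"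
  by (simp add: cres_def cong_def mod_diff_left_eq)

lemma cres_bound:
  assumes "odd N" "0 < N"
  shows "2 * \<bar>cres N x\<bar> < N"
proof -
  define m where "m = (x + N div 2) mod N"
  obtain b where b: "N = 2 * b + 1" using assms(1) by (elim oddE)
  have "0 \<le> m" "m < N" using assms by (auto simp: m_def)
  moreover have "cres N x = m - b" using b by (simp add: cres_def m_def)
  ultimately show ?thesis using b by arith
qed

lemma cong_small_eq:
  fixes N :: int
  assumes "[a = b] (mod N)" "\<bar>a - b\<bar> < N"
  shows "a = b"
  using assms zdvd_not_zless[of "\<bar>a - b\<bar>" N] by (auto simp: cong_iff_dvd_diff)

lemma cres_unique:
  assumes "odd N" "0 < N" "[w = x] (mod N)" "2 * \<bar>w\<bar> < N"
  shows "cres N x = w"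
proof (rule cong_small_eq)
  show "[cres N x = w] (mod N)" using cres_cong assms(3) by (metis cong_sym cong_trans)
  show "\<bar>cres N x - w\<bar> < N" using cres_bound[OF assms(1,2), of x] assms(4) by linarith
qed

lemma cres_minimal:
  assumes "odd N" "0 < N" "[w = x] (mod N)"
  shows "\<bar>cres N x\<bar> \<le> \<bar>w\<bar>"
proof (cases "2 * \<bar>w\<bar> < N")
  case True
  thus ?thesis using cres_unique[OF assms] by simp
next
  case False
  thus ?thesis using cres_bound[OF assms(1,2), of x] by linarith
qed

locale phase_grid =
  fixes n :: nat and u \<xi> :: int
  assumes u: "[2 * u = 1] (mod 3 ^ n)" and \<xi>: "\<not> 3 dvd \<xi>"
begin

abbreviation "N \<equiv> (3 :: int) ^ n"

text \<open>\<open>R i k / N\<close> is the phase difference between the flips head-tail and tail-head at \<open>(i, k)\<close>.\<close>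

definition R :: "nat \<Rightarrow> nat \<Rightarrow> int" where
  "R i k = cres N (3 ^ i * u ^ (2 * (k + 1)) * \<xi>)"

definition bl :: "nat \<Rightarrow> nat \<Rightarrow> bool" where
  "bl i k \<longleftrightarrow> 16 * \<bar>R i k\<bar> \<le> N"

lemma N_props: "odd N" "0 < N"
  by simp_all

lemma R_bound: "2 * \<bar>R i k\<bar> < N"
  unfolding R_def by (rule cres_bound) (simp_all)

lemma R_cong: "[R i k = 3 ^ i * u ^ (2 * (k + 1)) * \<xi>] (mod N)"
  unfolding R_def by (rule cres_cong)

lemma R_minimal: "[w = R i k] (mod N) \<Longrightarrow> \<bar>R i k\<bar> \<le> \<bar>w\<bar>"
  using cres_minimal[OF N_props, of w "3 ^ i * u ^ (2 * (k + 1)) * \<xi>"] R_cong[of i k]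
  unfolding R_def[symmetric] by (metis cong_trans)

lemma R_add_left: "[R (i + d) k = 3 ^ d * R i k] (mod N)"
proof -
  have "[3 ^ d * R i k = 3 ^ d * (3 ^ i * u ^ (2 * (k + 1)) * \<xi>)] (mod N)"
    by (intro cong_mult cong_refl R_cong)
  also have "3 ^ d * (3 ^ i * u ^ (2 * (k + 1)) * \<xi>) = 3 ^ (i + d) * u ^ (2 * (k + 1)) * \<xi>"
    by (simp add: power_add)
  finally show ?thesis using R_cong[of "i + d" k] by (metis cong_sym cong_trans)
qed

lemma R_add_right: "[4 ^ t * R i (k + t) = R i k] (mod N)"
proof -
  have "[4 ^ t * R i (k + t) = 4 ^ t * (3 ^ i * u ^ (2 * (k + t + 1)) * \<xi>)] (mod N)"
    by (intro cong_mult cong_refl R_cong)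
  also have "4 ^ t * (3 ^ i * u ^ (2 * (k + t + 1)) * \<xi>) = (2 * u) ^ (2 * t) * (3 ^ i * u ^ (2 * (k + 1)) * \<xi>)"
  proof -
    have "u ^ (2 * (k + t + 1)) = u ^ (2 * t) * u ^ (2 * (k + 1))"
      by (simp add: power_add[symmetric] algebra_simps)
    moreover have "(4::int) ^ t = 2 ^ (2 * t)" by (simp add: power_mult)
    ultimately show ?thesis by (simp only: power_mult_distrib mult_ac)
  qed
  also have "[(2 * u) ^ (2 * t) * (3 ^ i * u ^ (2 * (k + 1)) * \<xi>) = 1 ^ (2 * t) * (3 ^ i * u ^ (2 * (k + 1)) * \<xi>)] (mod N)"
    by (intro cong_mult cong_pow u cong_refl)
  also have "[1 ^ (2 * t) * (3 ^ i * u ^ (2 * (k + 1)) * \<xi>) = R i k] (mod N)"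
    using cong_sym[OF R_cong] by simp
  finally show ?thesis .
qed

text \<open>For two consecutive black points the congruence \<open>4 * R i (k + 1) = R i k\<close>
  is an equality, since both sides are too small to differ by a nonzero multiple of
  \<open>N\<close>.\<close>

lemma R_column:
  assumes "\<And>t. t \<le> m \<Longrightarrow> bl i (k + t)"
  shows "R i k = 4 ^ m * R i (k + m)"
  using assms
proof (induction m)
  case (Suc m)
  have "4 * R i (k + Suc m) = R i (k + m)"
  proof (rule cong_small_eq)
    show "[4 * R i (k + Suc m) = R i (k + m)] (mod N)"
      using R_add_right[of 1 i "k + m"] by simp
    show "\<bar>4 * R i (k + Suc m) - R i (k + m)\<bar> < N"
      using Suc.prems[of m] Suc.prems[of "Suc m"] N_props(2) unfolding bl_def by linarith
  qed
  moreover have "R i k = 4 ^ m * R i (k + m)" using Suc by simp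
  ultimately show ?case by simp
qed simp

text \<open>
  At the exit of a black run, \<open>R\<close> is \<open>N * e / 4\<close> plus a small error with \<open>4\<close> not dividing \<open>e\<close>,
  and multiplication by powers of \<open>3\<close> preserves this as long as the error stays small.
\<close>

lemma exits_white:
  assumes ex: "exits bl i k h" and d: "(3::nat) ^ d \<le> 4 ^ h"
  shows "\<not> bl (i + d) (k + h)"
proof (cases h)
  case 0
  have "d = 0" using d 0 one_less_power[of "3::nat" d] by (cases "d = 0") auto
  thus ?thesis using ex 0 by (simp add: exits_def)
next
  case (Suc m)
  define a where "a = R i (k + h)"
  define b where "b = R (i + d) (k + h)"
  define r where "r = R i (k + m)"
  have black: "bl i (k + t)" if "t \<le> m" for t using ex that Suc by (simp add: exits_def)
  have r: "16 * (4 ^ m * \<bar>r\<bar>) \<le> N"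
    using R_column[OF black, of m] black[of 0] by (simp add: bl_def r_def abs_mult)
  have "[4 * a = r] (mod N)"
    using R_add_right[of 1 i "k + m"] by (simp add: a_def r_def Suc)
  then obtain e where e: "4 * a = r + e * N" by (metis cong_iff_lin cong_sym mult.commute)
  \<comment> \<open>Otherwise \<open>a\<close> would be congruent to \<open>r / 4\<close>, and the
    exit point would be black.\<close>
  have e4: "\<not> 4 dvd e"
  proof
    assume "4 dvd e"
    then obtain e' where e': "e = 4 * e'" by (elim dvdE)
    have "\<bar>a\<bar> \<le> \<bar>a - e' * N\<bar>"
      unfolding a_def by (rule R_minimal) (simp add: cong_iff_dvd_diff)
    moreover have "4 * (a - e' * N) = r" using e e' by simp
    hence "4 * \<bar>a - e' * N\<bar> = \<bar>r\<bar>" by (metis abs_mult abs_numeral)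
    ultimately have "4 * \<bar>a\<bar> \<le> \<bar>r\<bar>" by (metis mult_left_mono zero_le_numeral)
    also have "\<bar>r\<bar> \<le> 4 ^ m * \<bar>r\<bar>" by (simp add: mult_le_cancel_right1)
    finally have "bl i (k + h)" using r by (simp add: bl_def a_def)
    thus False using ex by (simp add: exits_def)
  qed
  have "[b = 3 ^ d * a] (mod N)" unfolding a_def b_def by (rule R_add_left)
  then obtain g where g: "b = 3 ^ d * a + g * N" by (metis cong_iff_lin cong_sym mult.commute)
  have "4 * b = 3 ^ d * (4 * a) + 4 * g * N" using g by simp
  also have "\<dots> = 3 ^ d * r + (3 ^ d * e + 4 * g) * N" unfolding e by (simp add: algebra_simps)
  finally have b: "4 * b = 3 ^ d * r + (3 ^ d * e + 4 * g) * N" .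
  have "3 ^ d * e + 4 * g \<noteq> 0"
  proof
    assume "3 ^ d * e + 4 * g = 0"
    hence "3 ^ d * e = 4 * (- g)" by simp
    hence "4 dvd 3 ^ d * e" by (metis dvd_triv_left)
    moreover have "coprime (2 * 2 :: int) (3 ^ d)" unfolding coprime_mult_left_iff by simp
    ultimately have "4 dvd e" by (simp add: coprime_dvd_mult_right_iff)
    thus False using e4 by simp
  qed
  hence "1 * N \<le> \<bar>3 ^ d * e + 4 * g\<bar> * N" by (intro mult_right_mono) auto
  also have "\<dots> = \<bar>4 * b - 3 ^ d * r\<bar>" using b by (simp add: abs_mult)
  finally have "N \<le> 4 * \<bar>b\<bar> + 3 ^ d * \<bar>r\<bar>"
    using abs_triangle_ineq4[of "4 * b" "3 ^ d * r"] by (simp add: abs_mult)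
  moreover have "3 ^ d * \<bar>r\<bar> \<le> 4 ^ h * \<bar>r\<bar>"
  proof -
    have "int (3 ^ d) \<le> int (4 ^ h)" using d by (simp only: of_nat_le_iff)
    thus ?thesis by (intro mult_right_mono) auto
  qed
  moreover have "4 ^ h * \<bar>r\<bar> = 4 * (4 ^ m * \<bar>r\<bar>)" using Suc by simp
  \<comment> \<open>The error \<open>3 ^ d * \<bar>r\<bar>\<close> is at most \<open>N / 4\<close>,
    so \<open>\<bar>b\<bar>\<close> is at least \<open>3 * N / 16\<close>.\<close>
  ultimately have "N < 16 * \<bar>b\<bar>" using r N_props(2) by linarith
  thus ?thesis by (simp add: bl_def b_def)
qed

text \<open>
  Going up a long black run divides \<open>R\<close> exactly by powers of \<open>4\<close>, so that \<open>R y = 3 ^ (y - x) * R x\<close>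
  holds without reduction modulo \<open>N\<close>; but \<open>R x\<close> cannot be small so soon after the exit row.
\<close>

lemma separated:
  assumes ex: "exits bl i k h" and x: "i \<le> x" and xy: "x < y" and d: "(3::nat) ^ (x - i) \<le> 4 ^ h"
    and bx: "\<And>t. t \<le> s \<Longrightarrow> bl x (k + h + q + t)" and by': "\<And>t. t \<le> s \<Longrightarrow> bl y (k + h + q + t)"
    and s: "y - x \<le> s"
  shows "y - x \<le> 2 * q"
proof -
  define e where "e = y - x"
  have y: "y = x + e" using xy by (simp add: e_def)
  define k' where "k' = k + h + q"
  have pow34: "(3::int) ^ e \<le> 4 ^ s"
  proof -
    have "(3::int) ^ e \<le> 3 ^ s" using s by (intro power_increasing) (auto simp: e_def)
    also have "\<dots> \<le> 4 ^ s" by (intro power_mono) auto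
    finally show ?thesis .
  qed
  have cx: "R x k' = 4 ^ s * R x (k' + s)" by (rule R_column) (simp add: k'_def bx)
  have cy: "R y k' = 4 ^ s * R y (k' + s)" by (rule R_column) (simp add: k'_def by')
  have "R y (k' + s) = 3 ^ e * R x (k' + s)"
  proof (rule cong_small_eq)
    show "[R y (k' + s) = 3 ^ e * R x (k' + s)] (mod N)" unfolding y by (rule R_add_left)
    have "\<bar>3 ^ e * R x (k' + s)\<bar> \<le> 4 ^ s * \<bar>R x (k' + s)\<bar>"
      using pow34 by (simp add: abs_mult mult_right_mono)
    also have "\<dots> = \<bar>R x k'\<bar>" using cx by (simp add: abs_mult)
    finally show "\<bar>R y (k' + s) - 3 ^ e * R x (k' + s)\<bar> < N"
      using R_bound[of y "k' + s"] R_bound[of x k'] by linarith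
  qed
  hence "R y k' = 3 ^ e * R x k'" using cx cy by simp
  hence small: "16 * (3 ^ e * \<bar>R x k'\<bar>) \<le> N"
    using by'[of 0] by (simp add: bl_def k'_def abs_mult)
  \<comment> \<open>Column \<open>x\<close> is white in the exit row, so \<open>q\<close> rows
    higher its residue still exceeds \<open>N / (16 * 4 ^ q)\<close>.\<close>
  have "\<not> bl (i + (x - i)) (k + h)" by (rule exits_white[OF ex d])
  hence "N < 16 * \<bar>R x (k + h)\<bar>" using x by (simp add: bl_def)
  also have "\<bar>R x (k + h)\<bar> \<le> \<bar>4 ^ q * R x k'\<bar>"
    unfolding k'_def by (rule R_minimal[OF R_add_right])
  finally have "3 ^ e * \<bar>R x k'\<bar> < 4 ^ q * \<bar>R x k'\<bar>" using small by (simp add: abs_mult)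
  hence lt: "(3::int) ^ e < 4 ^ q" by (rule mult_right_less_imp_less) simp
  show ?thesis
  proof (rule ccontr)
    assume "\<not> y - x \<le> 2 * q"
    hence "(3::int) ^ (2 * q) \<le> 3 ^ e" by (intro power_increasing) (auto simp: e_def)
    moreover have "(4::int) ^ q \<le> 9 ^ q" by (intro power_mono) auto
    ultimately show False using lt by (simp add: power_mult)
  qed
qed

lemma not_3_dvd_u: "n \<noteq> 0 \<Longrightarrow> \<not> 3 dvd u"
proof
  assume n: "n \<noteq> 0" and "3 dvd u"
  have "(3::int) dvd 3 ^ n" using n by simp
  hence "[2 * u = 1] (mod 3)" using u cong_dvd_modulus by blast
  moreover have "[2 * u = 0] (mod 3)" using \<open>3 dvd u\<close> by (simp add: cong_0_iff)
  ultimately have "[1 = (0::int)] (mod 3)" by (metis cong_sym cong_trans)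
  thus False by (simp add: cong_def)
qed

text \<open>The residue is a multiple of \<open>3 ^ i\<close>, and it is nonzero because
  \<open>3\<close> divides neither \<open>u\<close> nor \<open>\<xi>\<close>.\<close>

lemma R_large:
  assumes "i < n"
  shows "3 ^ i \<le> \<bar>R i k\<bar>"
proof -
  have "3 ^ i dvd N" using assms by (intro le_imp_power_dvd) simp
  moreover have "N dvd R i k - 3 ^ i * u ^ (2 * (k + 1)) * \<xi>"
    using R_cong cong_iff_dvd_diff by blast
  ultimately have "3 ^ i dvd R i k - 3 ^ i * u ^ (2 * (k + 1)) * \<xi>" by (rule dvd_trans)
  moreover have "3 ^ i dvd 3 ^ i * u ^ (2 * (k + 1)) * \<xi>" by (simp add: mult.assoc)
  ultimately have dvd: "3 ^ i dvd R i k" by (metis dvd_add diff_add_cancel)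
  have "R i k \<noteq> 0"
  proof
    assume "R i k = 0"
    hence "N dvd 3 ^ i * (u ^ (2 * (k + 1)) * \<xi>)"
      using R_cong[of i k] by (metis cong_0_iff cong_sym mult.assoc)
    moreover have "N = 3 ^ i * 3 ^ (n - i)" using assms by (simp add: power_add[symmetric])
    ultimately have "3 ^ (n - i) dvd u ^ (2 * (k + 1)) * \<xi>" by simp
    moreover have "3 dvd (3::int) ^ (n - i)" using assms by simp
    ultimately have "3 dvd u ^ (2 * (k + 1)) * \<xi>" by (metis dvd_trans)
    moreover have p: "prime (3::int)" by simp
    ultimately have "3 dvd u ^ (2 * (k + 1))" using \<xi> prime_dvd_mult_iff by blast
    hence "3 dvd u" by (rule prime_dvd_power[OF p])
    thus False using not_3_dvd_u assms by simp
  qed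
  thus ?thesis using dvd_imp_le_int[OF _ dvd] by simp
qed

text \<open>\<open>R_column\<close> and \<open>R_large\<close> give
  \<open>4 ^ m \<le> 3 ^ (n - i)\<close>, and \<open>3 ^ 5 \<le> 4 ^ 4\<close>. As
  \<open>9 / 8 * 4 / 5 = 9 / 10\<close>, a tenth of the missing heads remains in
  \<open>long_block\<close>.\<close>

lemma column_length:
  assumes i: "i < n" and black: "\<And>t. t < m \<Longrightarrow> bl i (k + t)"
  shows "5 * m \<le> 4 * (n - i)"
proof (cases m)
  case (Suc l)
  have "R i k = 4 ^ l * R i (k + l)" using black Suc by (intro R_column) simp
  hence "16 * (4 ^ l * \<bar>R i (k + l)\<bar>) \<le> N"
    using black[of 0] Suc by (simp add: bl_def abs_mult)
  moreover have "4 ^ l * 3 ^ i \<le> 4 ^ l * \<bar>R i (k + l)\<bar>"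
    by (intro mult_left_mono R_large i) simp
  moreover have "4 ^ m * 3 ^ i = 4 * (4 ^ l * (3::int) ^ i)" using Suc by simp
  ultimately have "4 ^ m * 3 ^ i \<le> N" using N_props(2) by linarith
  also have "N = 3 ^ (n - i) * 3 ^ i" using i by (simp add: power_add[symmetric])
  finally have "(4::int) ^ m \<le> 3 ^ (n - i)" by simp
  hence "((4::int) ^ m) ^ 5 \<le> (3 ^ (n - i)) ^ 5" by (intro power_mono) auto
  also have "\<dots> = (3 ^ 5) ^ (n - i)" by (simp only: power_mult[symmetric] mult.commute)
  also have "\<dots> \<le> (4 ^ 4) ^ (n - i)" by (intro power_mono) auto
  finally have "(4::int) ^ (5 * m) \<le> 4 ^ (4 * (n - i))" by (simp only: power_mult[symmetric] mult.commute)
  thus ?thesis by (rule power_le_imp_le_exp[rotated]) simp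
qed simp

lemma exits_ex:
  assumes i: "i < n"
  shows "\<exists>h. exits bl i k h \<and> 5 * h \<le> 4 * (n - i)"
proof -
  have "\<exists>m. \<not> bl i (k + m)"
    using column_length[OF i, of "4 * n + 1" k] by fastforce
  then obtain h where h: "\<not> bl i (k + h)" "\<And>t. t < h \<Longrightarrow> bl i (k + t)"
    using exists_least_iff[of "\<lambda>m. \<not> bl i (k + m)"] by blast
  thus ?thesis using column_length[OF i, of h k] by (auto simp: exits_def)
qed

end

section \<open>The characteristic function of the Syracuse random variable\<close>

lemma norm_expectation_le_1:
  fixes f :: "'b \<Rightarrow> complex"
  assumes "\<And>y. norm (f y) \<le> 1"
  shows "norm (measure_pmf.expectation p f) \<le> 1"
proof -
  have int: "integrable (measure_pmf p) f"
    by (rule measure_pmf.integrable_const_bound[where B = 1]) (use assms in auto)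
  have "norm (measure_pmf.expectation p f) \<le> measure_pmf.expectation p (\<lambda>x. norm (f x))"
    by (rule integral_norm_bound)
  also have "\<dots> \<le> 1"
    by (rule measure_pmf.integral_le_const) (use int assms in auto)
  finally show ?thesis .
qed

lemma integral_bind_pmf_complex:
  fixes f :: "'b \<Rightarrow> complex"
  assumes bounded: "\<And>y. norm (f y) \<le> 1"
  shows "measure_pmf.expectation (bind_pmf M K) f =
    measure_pmf.expectation M (\<lambda>x. measure_pmf.expectation (K x) f)"
proof -
  have int: "integrable (measure_pmf p) f" for p :: "'b pmf"
    by (rule measure_pmf.integrable_const_bound[where B = 1]) (use bounded in auto)
  have int': "integrable (measure_pmf M) (\<lambda>x. measure_pmf.expectation (K x) f)"
    by (rule measure_pmf.integrable_const_bound[where B = 1])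
       (auto intro: norm_expectation_le_1 bounded)
  have real: "measure_pmf.expectation (bind_pmf M K) g = measure_pmf.expectation M (\<lambda>x. measure_pmf.expectation (K x) g)"
    if "\<And>y. \<bar>g y\<bar> \<le> 1" for g :: "'b \<Rightarrow> real"
    unfolding measure_pmf_bind
    by (rule integral_bind[where K = "count_space UNIV" and B = 1 and B' = 1])
       (use that measurable_measure_pmf[of K] in \<open>auto intro: measure_pmf.finite_measure_axioms simp: measure_pmf.emeasure_space_1[simplified]\<close>)
  have "\<bar>Re (f y)\<bar> \<le> 1" "\<bar>Im (f y)\<bar> \<le> 1" for y
    using bounded[of y] abs_Re_le_cmod[of "f y"] abs_Im_le_cmod[of "f y"] by linarith+
  hence "Re (measure_pmf.expectation (bind_pmf M K) f) = Re (measure_pmf.expectation M (\<lambda>x. measure_pmf.expectation (K x) f))"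
    "Im (measure_pmf.expectation (bind_pmf M K) f) = Im (measure_pmf.expectation M (\<lambda>x. measure_pmf.expectation (K x) f))"
    by (simp_all add: integral_Re[OF int, symmetric] integral_Im[OF int, symmetric]
        integral_Re[OF int', symmetric] integral_Im[OF int', symmetric] real)
  thus ?thesis by (rule complex_eqI)
qed

text \<open>The number of flips of a fair coin up to and including the first head.\<close>

lemma geom2_pmf_unfold:
  "geom2_pmf = bind_pmf (bernoulli_pmf (1 / 2)) (\<lambda>b. if b then return_pmf 1 else map_pmf Suc geom2_pmf)"
proof -
  have "geom2_pmf = map_pmf Suc (bind_pmf (bernoulli_pmf (1 / 2))
      (\<lambda>b. if b then return_pmf 0 else map_pmf Suc (geometric_pmf (1 / 2))))"
    unfolding geom2_pmf_def by (subst geometric_bind_pmf_unfold) auto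
  also have "\<dots> = bind_pmf (bernoulli_pmf (1 / 2)) (\<lambda>b. if b then return_pmf 1 else map_pmf Suc geom2_pmf)"
    unfolding map_bind_pmf geom2_pmf_def by (intro bind_pmf_cong) auto
  finally show ?thesis .
qed

lemma expectation_geom2:
  fixes f :: "nat \<Rightarrow> complex"
  assumes "\<And>y. norm (f y) \<le> 1"
  shows "measure_pmf.expectation geom2_pmf f =
    f 1 / 2 + measure_pmf.expectation geom2_pmf (\<lambda>a. f (Suc a)) / 2"
  by (subst geom2_pmf_unfold, subst integral_bind_pmf_complex[OF assms]) 
     (subst integral_measure_pmf[of UNIV], auto simp: UNIV_bool scaleR_conv_of_real)

text \<open>\<open>offs\<close> is \<open>syrac_offset\<close> with \<open>1/2\<close> replaced by an integer \<open>u\<close> inverse to \<open>2\<close> modulo \<open>3\<^sup>n\<close>.\<close>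

primrec offs :: "int \<Rightarrow> nat \<Rightarrow> (nat \<Rightarrow> nat) \<Rightarrow> int" where
  "offs u 0 a = 0"
| "offs u (Suc m) a = u ^ a (Suc m) * (3 * offs u m a + 1)"

lemma offs_cong: "(\<And>i. i \<in> {1..m} \<Longrightarrow> a i = b i) \<Longrightarrow> offs u m a = offs u m b"
  by (induction m) auto

definition chi :: "nat \<Rightarrow> int \<Rightarrow> complex" where
  "chi n x = cis (- 2 * pi * real_of_int x / 3 ^ n)"

lemma norm_chi [simp]: "norm (chi n x) = 1"
  by (simp add: chi_def)

lemma chi_add: "chi n (x + y) = chi n x * chi n y"
  unfolding chi_def cis_mult by (rule arg_cong[of _ _ cis]) (simp add: field_simps)

lemma chi_cong:
  assumes "[x = y] (mod 3 ^ n)"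
  shows "chi n x = chi n y"
proof -
  obtain k where k: "x = y + 3 ^ n * k" using assms by (metis cong_iff_lin cong_sym)
  have "- 2 * pi * real_of_int (3 ^ n * k) / 3 ^ n = 2 * pi * real_of_int (- k)" by simp
  hence "chi n (3 ^ n * k) = 1"
    unfolding chi_def by (simp only: cis_multiple_2pi Ints_of_int)
  thus ?thesis by (simp add: k chi_add)
qed

text \<open>Here \<open>m\<close> is the number of heads still missing; the modulus
  \<open>3 ^ n\<close> stays fixed while \<open>m\<close> decreases.\<close>

definition syrac_char :: "nat \<Rightarrow> int \<Rightarrow> nat \<Rightarrow> int \<Rightarrow> complex" where
  "syrac_char n u m x = measure_pmf.expectation (Pi_pmf {1..m} 0 (\<lambda>_. geom2_pmf)) (\<lambda>a. chi n (x * offs u m a))"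

lemma norm_syrac_char: "norm (syrac_char n u m x) \<le> 1"
  unfolding syrac_char_def by (rule norm_expectation_le_1) simp

lemma syrac_char_0 [simp]: "syrac_char n u 0 x = 1"
  by (simp add: syrac_char_def chi_def)

lemma syrac_char_Suc_expectation:
  "syrac_char n u (Suc m) x =
    measure_pmf.expectation geom2_pmf (\<lambda>g. chi n (x * u ^ g) * syrac_char n u m (3 * (x * u ^ g)))"
proof -
  have ins: "{1..Suc m} = insert (Suc m) {1..m}" by auto
  have upd: "offs u m (a(Suc m := y)) = offs u m a" for a y
    by (rule offs_cong) auto
  have split: "chi n (x * u ^ g * (3 * offs u m a + 1)) = chi n (x * u ^ g) * chi n (3 * (x * u ^ g) * offs u m a)" for g a
    by (simp add: chi_add[symmetric] algebra_simps)
  have "syrac_char n u (Suc m) x = measure_pmf.expectation geom2_pmf (\<lambda>g.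
      measure_pmf.expectation (Pi_pmf {1..m} 0 (\<lambda>_. geom2_pmf)) (\<lambda>a. chi n (x * u ^ g * (3 * offs u m a + 1))))"
    unfolding syrac_char_def ins
    by (subst Pi_pmf_insert') (simp_all add: integral_bind_pmf_complex upd mult.assoc)
  thus ?thesis by (simp add: split syrac_char_def)
qed

text \<open>One flip: a head closes the current gap, with a phase, and a tail only multiplies the
  frequency by \<open>u\<close>.\<close>

lemma syrac_char_Suc:
  "syrac_char n u (Suc m) x =
    (chi n (u * x) * syrac_char n u m (3 * u * x) + syrac_char n u (Suc m) (u * x)) / 2"
proof -
  have bound: "norm (chi n (x * u ^ g) * syrac_char n u m (3 * (x * u ^ g))) \<le> 1" for g
    using norm_syrac_char by (simp add: norm_mult)
  show ?thesis
    unfolding syrac_char_Suc_expectation[of n u m x] syrac_char_Suc_expectation[of n u m "u * x"]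
    by (subst expectation_geom2[OF bound]) (simp add: mult_ac add_divide_distrib)
qed

lemma syrac_offset_Suc:
  "syrac_offset (Suc m) a = (3 * syrac_offset m a + 1) / 2 ^ a (Suc m)"
proof -
  have "syrac_offset (Suc m) a = (\<Sum>j = 1..m. 3 ^ (Suc m - j) * 2 powi (- int (\<Sum>i = j..Suc m. a i))) + 1 / 2 ^ a (Suc m)"
    by (simp add: syrac_offset_def power_int_minus divide_inverse)
  also have "(\<Sum>j = 1..m. 3 ^ (Suc m - j) * 2 powi (- int (\<Sum>i = j..Suc m. a i)) :: rat)
      = (\<Sum>j = 1..m. 3 * (3 ^ (m - j) * 2 powi (- int (\<Sum>i = j..m. a i))) / 2 ^ a (Suc m))"
  proof (rule sum.cong)
    fix j assume "j \<in> {1..m}"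
    hence "(\<Sum>i = j..Suc m. a i) = (\<Sum>i = j..m. a i) + a (Suc m)" "Suc m - j = Suc (m - j)" by auto
    thus "3 ^ (Suc m - j) * 2 powi (- int (\<Sum>i = j..Suc m. a i))
        = (3 * (3 ^ (m - j) * 2 powi (- int (\<Sum>i = j..m. a i))) / 2 ^ a (Suc m) :: rat)"
      by (simp only:) (simp add: power_int_minus power_add divide_inverse flip: of_nat_sum of_nat_add)
  qed simp
  also have "\<dots> = 3 * syrac_offset m a / 2 ^ a (Suc m)"
    by (simp add: syrac_offset_def sum_distrib_left sum_divide_distrib)
  finally show ?thesis by (simp add: add_divide_distrib)
qed

lemma syrac_offset_eq_offs:
  assumes u: "[2 * u = 1] (mod 3 ^ n)"
  shows "\<exists>b K. syrac_offset m a = of_int b / 2 ^ K \<and> [b = 2 ^ K * offs u m a] (mod 3 ^ n)"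
proof (induction m)
  case 0
  show ?case by (intro exI[of _ 0]) (simp add: syrac_offset_def)
next
  case (Suc m)
  then obtain b K where b: "syrac_offset m a = of_int b / 2 ^ K" "[b = 2 ^ K * offs u m a] (mod 3 ^ n)" by blast
  define g where "g = a (Suc m)"
  have "syrac_offset (Suc m) a = of_int (3 * b + 2 ^ K) / 2 ^ (K + g)"
    unfolding syrac_offset_Suc b(1) g_def by (simp add: field_simps power_add)
  moreover have "[3 * b + 2 ^ K = 2 ^ (K + g) * offs u (Suc m) a] (mod 3 ^ n)"
  proof -
    have "[3 * b + 2 ^ K = 3 * (2 ^ K * offs u m a) + 2 ^ K] (mod 3 ^ n)"
      by (intro cong_add cong_mult cong_refl b(2))
    also have "3 * (2 ^ K * offs u m a) + 2 ^ K = 1 ^ g * (3 * (2 ^ K * offs u m a) + 2 ^ K)"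
      by simp
    also have "[1 ^ g * (3 * (2 ^ K * offs u m a) + 2 ^ K) = (2 * u) ^ g * (3 * (2 ^ K * offs u m a) + 2 ^ K)] (mod 3 ^ n)"
      by (intro cong_mult cong_pow cong_refl cong_sym[OF u])
    also have "(2 * u) ^ g * (3 * (2 ^ K * offs u m a) + 2 ^ K) = 2 ^ (K + g) * offs u (Suc m) a"
      by (simp add: g_def power_add power_mult_distrib algebra_simps)
    finally show ?thesis .
  qed
  ultimately show ?case by blast
qed

lemma expectation_syrac_eq_char:
  assumes n: "n \<ge> 1" and u: "[2 * u = 1] (mod 3 ^ n)"
  shows "measure_pmf.expectation (syrac_pmf n)
    (\<lambda>x. exp (- 2 * complex_of_real pi * \<i> * of_int \<xi> * of_int x / 3 ^ n)) = syrac_char n u n \<xi>"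
proof -
  have "exp (- 2 * complex_of_real pi * \<i> * of_int \<xi> * of_int x / 3 ^ n) = chi n (\<xi> * x)" for x
    by (simp add: chi_def cis_conv_exp mult_ac)
  moreover have "chi n (\<xi> * dyadic_mod n (syrac_offset n a)) = chi n (\<xi> * offs u n a)" for a
  proof (intro chi_cong cong_mult cong_refl)
    obtain b K where b: "syrac_offset n a = of_int b / 2 ^ K" "[b = 2 ^ K * offs u n a] (mod 3 ^ n)"
      using syrac_offset_eq_offs[OF u] by blast
    have "[dyadic_mod n (syrac_offset n a) * 2 ^ K = offs u n a * 2 ^ K] (mod 3 ^ n)"
      using cong_trans[OF dyadic_mod_cong[OF n] b(2)] unfolding b(1) by (simp add: mult.commute)
    thus "[dyadic_mod n (syrac_offset n a) = offs u n a] (mod 3 ^ n)"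
      unfolding cong_mult_rcancel[OF coprime_2_3_power] .
  qed
  ultimately show ?thesis by (simp add: syrac_pmf_def syrac_char_def)
qed

section \<open>Two flips and the phase difference\<close>

lemma norm_1_plus_cis: "norm (1 + cis t) = 2 * \<bar>cos (t / 2)\<bar>"
proof -
  have "1 + cis t = 2 * of_real (cos (t / 2)) * cis (t / 2)"
    using cos_double_cos[of "t / 2"] sin_double[of "t / 2"]
    by (simp add: complex_eq_iff power2_eq_square)
  thus ?thesis by (simp add: norm_mult)
qed

text \<open>Head-tail and tail-head both lead to \<open>q\<close>, with phases
  \<open>e\<^sup>2\<close> and \<open>e\<close>, which add up to \<open>e * (1 + e)\<close>.\<close>

lemma syrac_char_two_steps:
  assumes u: "[2 * u = 1] (mod 3 ^ n)" and m: "1 \<le> m"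
  shows "norm (syrac_char n u m x) \<le> norm (syrac_char n u m (u\<^sup>2 * x)) / 4
    + norm (1 + chi n (u\<^sup>2 * x)) / 2 * norm (syrac_char n u (m - 1) (3 * (u\<^sup>2 * x))) / 2
    + norm (syrac_char n u (m - 2) (9 * (u\<^sup>2 * x))) / 4"
proof -
  obtain l where l: "m = Suc l" using m by (cases m) auto
  define e where "e = chi n (u\<^sup>2 * x)"
  define p where "p = syrac_char n u m (u\<^sup>2 * x)"
  define q where "q = syrac_char n u l (3 * (u\<^sup>2 * x))"
  have "[1 * (u * x) = (2 * u) * (u * x)] (mod 3 ^ n)"
    by (intro cong_mult cong_refl cong_sym[OF u])
  hence "chi n (u * x) = chi n (u\<^sup>2 * x + u\<^sup>2 * x)"
    by (intro chi_cong) (simp add: power2_eq_square algebra_simps)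
  hence ux: "chi n (u * x) = e\<^sup>2" by (simp only: chi_add e_def power2_eq_square)
  have "\<exists>y. syrac_char n u l (3 * u * x) = (y + q) / 2 \<and> norm y \<le> norm (syrac_char n u (m - 2) (9 * (u\<^sup>2 * x)))"
  proof (cases l)
    \<comment> \<open>No head is missing after the first one; the value \<open>1\<close> is split as
      \<open>(1 + 1) / 2\<close>, and truncation makes \<open>m - 2\<close> equal to
      \<open>0\<close>.\<close>
    case 0
    thus ?thesis by (intro exI[of _ 1]) (simp add: q_def l)
  next
    case (Suc l')
    show ?thesis
      by (intro exI[of _ "chi n (3 * (u\<^sup>2 * x)) * syrac_char n u l' (9 * (u\<^sup>2 * x))"] conjI)
         (use syrac_char_Suc[of n u l' "3 * u * x"] in \<open>simp_all add: Suc l q_def norm_mult power2_eq_square mult_ac\<close>)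
  qed
  then obtain y where y: "syrac_char n u l (3 * u * x) = (y + q) / 2"
      "norm y \<le> norm (syrac_char n u (m - 2) (9 * (u\<^sup>2 * x)))" by blast
  have sx: "syrac_char n u m (u * x) = (e * q + p) / 2"
    using syrac_char_Suc[of n u l "u * x"] by (simp add: l e_def p_def q_def power2_eq_square mult_ac)
  have "syrac_char n u m x = (e\<^sup>2 * ((y + q) / 2) + (e * q + p) / 2) / 2"
    using syrac_char_Suc[of n u l x] unfolding l[symmetric] ux y(1) sx .
  also have "\<dots> = p / 4 + e * (1 + e) * q / 4 + e\<^sup>2 * y / 4"
    by (simp add: field_simps power2_eq_square)
  also have "norm \<dots> \<le> norm (p / 4) + norm (e * (1 + e) * q / 4) + norm (e\<^sup>2 * y / 4)"
    by (meson norm_triangle_ineq order_trans add_right_mono)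
  also have "\<dots> = norm p / 4 + norm (1 + e) / 2 * norm q / 2 + norm y / 4"
    by (simp add: norm_mult norm_divide norm_power e_def)
  finally show ?thesis using y(2) by (simp add: p_def q_def e_def l)
qed

context phase_grid begin

text \<open>So all points with \<open>n \<le> i\<close> are black, and damping has to be shown only
  for \<open>i < n\<close>.\<close>

lemma R_eq_0: "n \<le> i \<Longrightarrow> R i k = 0"
proof -
  assume "n \<le> i"
  hence "N dvd 3 ^ i" by (rule le_imp_power_dvd)
  hence "[0 = 3 ^ i * u ^ (2 * (k + 1)) * \<xi>] (mod N)" by (simp add: cong_iff_dvd_diff)
  hence "[0 = R i k] (mod N)" using R_cong by (metis cong_sym cong_trans)
  from R_minimal[OF this] show ?thesis by simp
qed

lemma norm_1_plus_chi_white: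
  assumes "\<not> bl i k"
  shows "norm (1 + chi n (3 ^ i * u ^ (2 * (k + 1)) * \<xi>)) / 2 \<le> cos (pi / 16)"
proof -
  define \<theta> where "\<theta> = \<bar>real_of_int (R i k)\<bar> / 3 ^ n"
  have "chi n (3 ^ i * u ^ (2 * (k + 1)) * \<xi>) = chi n (R i k)"
    by (rule chi_cong[OF cong_sym[OF R_cong]])
  hence "norm (1 + chi n (3 ^ i * u ^ (2 * (k + 1)) * \<xi>)) / 2 = \<bar>cos (- (pi * (real_of_int (R i k) / 3 ^ n)))\<bar>"
    by (simp add: chi_def norm_1_plus_cis)
  also have "\<dots> = \<bar>cos (pi * \<theta>)\<bar>"
    by (cases "0 \<le> R i k") (auto simp: \<theta>_def)
  also have "\<dots> \<le> cos (pi / 16)"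
  proof -
    have "real_of_int N < real_of_int (16 * \<bar>R i k\<bar>)" "real_of_int (2 * \<bar>R i k\<bar>) < real_of_int N"
      using assms R_bound[of i k] unfolding bl_def of_int_less_iff by auto
    hence \<theta>: "1 / 16 \<le> \<theta>" "\<theta> \<le> 1 / 2" by (simp_all add: \<theta>_def field_simps)
    have "cos (pi * \<theta>) \<le> cos (pi / 16)"
      using \<theta> mult_left_mono[OF \<theta>(1), of pi] mult_left_mono[OF \<theta>(2), of pi]
      by (intro cos_monotone_0_pi_le) auto
    moreover have "0 \<le> cos (pi * \<theta>)"
      using \<theta> mult_left_mono[OF \<theta>(2), of pi] by (intro cos_ge_zero) (auto intro: order_trans[of _ 0])
    ultimately show ?thesis by simp
  qed
  finally show ?thesis .
qed

lemma damped_walk_syrac_char: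
  "damped_walk n (\<lambda>i k. norm (syrac_char n u (n - i) (3 ^ i * u ^ (2 * k) * \<xi>))) bl ((1 - cos (pi / 16)) / 2)"
proof
  let ?\<eta> = "(1 - cos (pi / 16)) / 2"
  let ?F = "\<lambda>i k. norm (syrac_char n u (n - i) (3 ^ i * u ^ (2 * k) * \<xi>))"
  have "cos (pi / 16) < cos 0" by (rule cos_monotone_0_pi) auto
  thus "0 < ?\<eta>" by simp
  have "0 \<le> cos (pi / 16)" by (rule cos_ge_zero) auto
  thus "?\<eta> \<le> 1 / 2" by simp
  fix i k
  show "0 \<le> ?F i k" by simp
  show "?F i k \<le> 1" by (rule norm_syrac_char)
  define w where "w = norm (1 + chi n (3 ^ i * u ^ (2 * (k + 1)) * \<xi>)) / 2"
  have two_steps: "?F i k \<le> ?F i (k + 1) / 4 + w * ?F (i + 1) (k + 1) / 2 + ?F (i + 2) (k + 1) / 4" if "i < n"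
  proof -
    have "u\<^sup>2 * (3 ^ i * u ^ (2 * k) * \<xi>) = 3 ^ i * u ^ (2 * (k + 1)) * \<xi>"
      "3 * (u\<^sup>2 * (3 ^ i * u ^ (2 * k) * \<xi>)) = 3 ^ (i + 1) * u ^ (2 * (k + 1)) * \<xi>"
      "9 * (u\<^sup>2 * (3 ^ i * u ^ (2 * k) * \<xi>)) = 3 ^ (i + 2) * u ^ (2 * (k + 1)) * \<xi>"
      by (simp_all add: power_add power2_eq_square mult_ac)
    moreover have "1 \<le> n - i" "n - i - 1 = n - (i + 1)" "n - i - 2 = n - (i + 2)" using that by auto
    ultimately show ?thesis
      using syrac_char_two_steps[OF u, of "n - i" "3 ^ i * u ^ (2 * k) * \<xi>"] unfolding w_def by metis
  qed
  have w: "w \<le> 1"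
    unfolding w_def using norm_triangle_ineq[of 1 "chi n (3 ^ i * u ^ (2 * (k + 1)) * \<xi>)"] by simp
  show "?F i k \<le> ?F i (k + 1) / 4 + ?F (i + 1) (k + 1) / 2 + ?F (i + 2) (k + 1) / 4"
  proof (cases "i < n")
    case True
    have "w * ?F (i + 1) (k + 1) \<le> 1 * ?F (i + 1) (k + 1)" using w by (intro mult_right_mono) auto
    thus ?thesis using two_steps[OF True] by linarith
  qed simp
  show "?F i k \<le> ?F i (k + 1) / 4 + (1 - 2 * ?\<eta>) * ?F (i + 1) (k + 1) / 2 + ?F (i + 2) (k + 1) / 4"
    if white: "\<not> bl i k"
  proof -
    have "i < n" using white R_eq_0[of i k] by (cases "i < n") (auto simp: bl_def)
    have "w * ?F (i + 1) (k + 1) \<le> cos (pi / 16) * ?F (i + 1) (k + 1)"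
      unfolding w_def by (intro mult_right_mono norm_1_plus_chi_white white) auto
    moreover have "1 - 2 * ?\<eta> = cos (pi / 16)" by (simp add: field_simps)
    ultimately show ?thesis using two_steps[OF \<open>i < n\<close>] by (simp only:)
  qed
next
  show "\<exists>h. exits bl i k h \<and> 5 * h \<le> 4 * (n - i)" if "i < n" for i k
    using that by (rule exits_ex)
next
  show "\<not> bl (i + d) (k + h)" if "exits bl i k h" "(3::nat) ^ d \<le> 4 ^ h" for i k h d
    using that by (rule exits_white)
next
  show "y - x \<le> 2 * q" if "exits bl i k h" "i \<le> x" "x < y" "(3::nat) ^ (x - i) \<le> 4 ^ h"
    "\<And>t. t \<le> s \<Longrightarrow> bl x (k + h + q + t)" "\<And>t. t \<le> s \<Longrightarrow> bl y (k + h + q + t)" "y - x \<le> s" for i k h x y s q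
    using that by (rule separated)
qed

end

theorem proposition1p17:
  shows "\<forall>A::real. A > 0 \<longrightarrow> (\<exists>C::real. \<forall>n::nat. n \<ge> 1 \<longrightarrow>
    (\<forall>\<xi>::int. \<xi> \<in> carrier (residue_ring (3 ^ n)) \<and> \<not> 3 dvd \<xi> \<longrightarrow>
      cmod (measure_pmf.expectation (syrac_pmf n)
        (\<lambda>x. exp (- 2 * complex_of_real pi * \<i> * of_int \<xi> * of_int x / 3 ^ n)))
      \<le> C * real n powr (- A)))"
proof (intro allI impI)
  fix A :: real assume A: "A > 0"
  have "cos (pi / 16) < cos 0" by (rule cos_monotone_0_pi) auto
  moreover have "0 \<le> cos (pi / 16)" by (rule cos_ge_zero) auto
  ultimately obtain C where C: "\<And>n F bl. 1 \<le> n \<Longrightarrow> damped_walk n F bl ((1 - cos (pi / 16)) / 2) \<Longrightarrow>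
      F 0 0 \<le> C * real n powr (- A)"
    using damped_walk_decay[OF A, of "(1 - cos (pi / 16)) / 2"] by auto
  show "\<exists>C::real. \<forall>n::nat. n \<ge> 1 \<longrightarrow>
    (\<forall>\<xi>::int. \<xi> \<in> carrier (residue_ring (3 ^ n)) \<and> \<not> 3 dvd \<xi> \<longrightarrow>
      cmod (measure_pmf.expectation (syrac_pmf n)
        (\<lambda>x. exp (- 2 * complex_of_real pi * \<i> * of_int \<xi> * of_int x / 3 ^ n)))
      \<le> C * real n powr (- A))"
  proof (intro exI[of _ C] allI impI)
    fix n :: nat and \<xi> :: int
    assume n: "n \<ge> 1" and \<xi>: "\<xi> \<in> carrier (residue_ring (3 ^ n)) \<and> \<not> 3 dvd \<xi>"
    define u where "u = ((3::int) ^ n + 1) div 2"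
    have "2 * u = 3 ^ n + 1" unfolding u_def by (rule dvd_mult_div_cancel) simp
    hence u: "[2 * u = 1] (mod 3 ^ n)" by (simp add: cong_iff_dvd_diff)
    interpret phase_grid n u \<xi> by unfold_locales (use u \<xi> in auto)
    show "cmod (measure_pmf.expectation (syrac_pmf n)
        (\<lambda>x. exp (- 2 * complex_of_real pi * \<i> * of_int \<xi> * of_int x / 3 ^ n))) \<le> C * real n powr (- A)"
      unfolding expectation_syrac_eq_char[OF n u] using C[OF n damped_walk_syrac_char] by simp
  qed
qed

end
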